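(* Let $1<p<\infty$ and let $(F_n)_{n=1}^\infty$ be a sequence of Banach lattices such that, for every $n$, all Aron-Berner extensions of any $F_n$-valued Riesz multimorphism are Riesz multimorphisms. Then all Aron-Berner extensions of any $\left(\oplus_n F_n\right)_0$-valued Riesz multimorphism and of any $\left(\oplus_n F_n\right)_p$-valued Riesz multimorphism are Riesz multimorphisms.
   Context: All Banach lattices are real. For a sequence $(F_n)_{n=1}^\infty$ of Banach lattices and $1\le p<\infty$, $$\left(\oplus_n F_n\right)_p=\Big\{(x_n)_{n=1}^\infty: x_n\in F_n,\ \|(x_n)_{n=1}^\infty\|_p=\Big(\sum_{n=1}^\infty\|x_n\|^p\Big)^{1/p}<\infty\Big\},$$ $$\left(\oplus_n F_n\right)_0=\{(x_n)_{n=1}^\infty: x_n\in F_n,\ \|x_n\|\to 0\},\qquad \|(x_n)_{n=1}^\infty\|=\sup_n\|x_n\|,$$ which are Banach lattices with the coordinatewise order. For a Banach lattice $F$, the expression "all Aron-Berner extensions of any $F$-valued Riesz multimorphism are Riesz multimorphisms" means: for every $m\in\mathbb{N}$, all Banach lattices $E_1,\ldots,E_m$, every Riesz multimorphism $A\colon E_1\times\cdots\times E_m\to F$ and every $\rho\in S_m$, the Aron-Berner extension $AB_m^\rho(A)\colon E_1^{**}\times\cdots\times E_m^{**}\to F^{**}$ is a Riesz multimorphism. For a Banach lattice $E$, the topological dual $E^*$ coincides with the order dual and the bidual $E^{**}$ with the second order dual. $S_m$ is the set of permutations of $\{1,\ldots,m\}$. An $m$-linear operator $A\colon E_1\times\cdots\times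 E_m\to F$ is positive if $A(x_1,\ldots,x_m)\ge 0$ whenever all $x_i\ge 0$, and regular if it is a difference of two positive $m$-linear operators; $\mathcal{L}_r(E_1,\ldots,E_m;F)$ is the space of regular $m$-linear operators. A Riesz multimorphism is an $A\in\mathcal{L}_r(E_1,\ldots,E_m;F)$ with $|A(x_1,\ldots,x_m)|=A(|x_1|,\ldots,|x_m|)$ for all $x_i\in E_i$. Aron-Berner extensions: fix $\rho\in S_m$. For $0\le k\le m$ let $I_k=\{1,\ldots,m\}\setminus\{\rho(1),\ldots,\rho(k)\}$ and let $\mathcal{L}^{\rho,k}$ be the space of regular $(m-k)$-linear forms on the product of the spaces $E_i$, $i\in I_k$ (in increasing order of indices), with $\mathcal{L}^{\rho,m}=\mathbb{R}$. For $1\le k\le m$ and $x^{**}\in E_{\rho(k)}^{**}$ define $\overline{x^{**}}^{\rho}\colon\mathcal{L}^{\rho,k-1}\to\mathcal{L}^{\rho,k}$ by letting $\overline{x^{**}}^{\rho}(B)\big((x_i)_{i\in I_k}\big)$ be the value of $x^{**}$ at the functional $x_{\rho(k)}\mapsto B\big((x_i)_{i\in I_{k-1}}\big)$ in $E_{\rho(k)}^*$. For $A\in\mathcal{L}_r(E_1,\ldots,E_m;F)$ the Aron-Berner extension $AB_m^\rho(A)\colon E_1^{**}\times\cdots\times E_m^{**}\to F^{**}$ is $$AB_m^\rho(A)(x_1^{**},\ldots,x_m^{**})(y^* )=\big(\overline{x_{\rho(m)}^{**}}^{\rho}\circ\cdots\circ\overline{x_{\rho(1)}^{**}}^{\rho}\big)(y^*\circ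 A),\quad y^*\in F^*.$$ *)

theory Defs
  imports
    Complex_Main
    "HOL-Library.Function_Algebras"
    "HOL-Library.FuncSet"
    "HOL-Combinatorics.Permutations"
    "HOL-Algebra.Lattice"
begin

instantiation "fun" :: (type, real_vector) real_vector
begin

definition "r *\<^sub>R f = (\<lambda>x. r *\<^sub>R f x)"

instance
  by standard (simp_all add: scaleR_fun_def fun_eq_iff scaleR_add_right scaleR_add_left)

end

section \<open>Banach lattices\<close>

text \<open>
  The Banach lattices \<open>F\<^sub>n\<close> differ from one another, and so do the domains \<open>E\<^sub>1, \<dots>, E\<^sub>m\<close>, which are
  moreover quantified inside a hypothesis; so a Banach lattice is not rendered as a type but as a
  linear subspace of an arbitrary real vector space type, with its own norm and its own order.
  The fields \<open>le\<close> and \<open>lnorm\<close> are meaningful on the carrier only. The field \<open>eq\<close> is inherited from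
  \<open>gorder\<close>; the locale \<open>lattice\<close> requires it to be equality.
\<close>

record 'a normed_order = "'a gorder" +
  lnorm :: "'a \<Rightarrow> real"

definition modulus :: "('a::real_vector, 'b) gorder_scheme \<Rightarrow> 'a \<Rightarrow> 'a" where
  "modulus L x = join L x (- x)"

locale banach_lattice = lattice L for L :: "'a::real_vector normed_order" (structure) +
  assumes subspace_carrier: "subspace (carrier L)"
    and add_right_mono:
      "\<lbrakk>x \<in> carrier L; y \<in> carrier L; z \<in> carrier L; x \<sqsubseteq> y\<rbrakk> \<Longrightarrow> x + z \<sqsubseteq> y + z"
    and scaleR_nonneg:
      "\<lbrakk>x \<in> carrier L; 0 \<sqsubseteq> x; 0 \<le> c\<rbrakk> \<Longrightarrow> 0 \<sqsubseteq> c *\<^sub>R x"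
    and lnorm_eq_0_iff: "x \<in> carrier L \<Longrightarrow> lnorm L x = 0 \<longleftrightarrow> x = 0"
    and lnorm_triangle:
      "\<lbrakk>x \<in> carrier L; y \<in> carrier L\<rbrakk> \<Longrightarrow> lnorm L (x + y) \<le> lnorm L x + lnorm L y"
    and lnorm_scaleR: "x \<in> carrier L \<Longrightarrow> lnorm L (c *\<^sub>R x) = \<bar>c\<bar> * lnorm L x"
    and lnorm_mono:
      "\<lbrakk>x \<in> carrier L; y \<in> carrier L; modulus L x \<sqsubseteq> modulus L y\<rbrakk> \<Longrightarrow> lnorm L x \<le> lnorm L y"
    and complete:
      "\<lbrakk>\<And>n. s n \<in> carrier L;
        \<And>e. e > 0 \<Longrightarrow> \<exists>N. \<forall>i\<ge>N. \<forall>j\<ge>N. lnorm L (s i - s j) < e\<rbrakk>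
       \<Longrightarrow> \<exists>x\<in>carrier L. (\<lambda>n. lnorm L (s n - x)) \<longlonglongrightarrow> 0"

text \<open>
  Functionals are extended by \<open>0\<close> outside the carrier. In this way the dual is again a linear
  subspace of a function space and equality of functionals is equality on the carrier.
\<close>

definition dual_lattice :: "'a::real_vector normed_order \<Rightarrow> ('a \<Rightarrow> real) normed_order" where
  "dual_lattice L =
    \<lparr>carrier =
       {f. (\<forall>x\<in>carrier L. \<forall>y\<in>carrier L. f (x + y) = f x + f y) \<and>
           (\<forall>c. \<forall>x\<in>carrier L. f (c *\<^sub>R x) = c * f x) \<and>
           (\<exists>K. \<forall>x\<in>carrier L. \<bar>f x\<bar> \<le> K * lnorm L x) \<and>
           (\<forall>x. x \<notin> carrier L \<longrightarrow> f x = 0)},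
     eq = (=),
     le = (\<lambda>f g. \<forall>x\<in>carrier L. le L 0 x \<longrightarrow> f x \<le> g x),
     lnorm = (\<lambda>f. SUP x\<in>{x \<in> carrier L. lnorm L x \<le> 1}. \<bar>f x\<bar>)\<rparr>"

abbreviation bidual :: "'a::real_vector normed_order \<Rightarrow> (('a \<Rightarrow> real) \<Rightarrow> real) normed_order" where
  "bidual L \<equiv> dual_lattice (dual_lattice L)"

definition lp_sum :: "real \<Rightarrow> (nat \<Rightarrow> 'f::real_vector normed_order) \<Rightarrow> (nat \<Rightarrow> 'f) normed_order" where
  "lp_sum p F =
    \<lparr>carrier = {x. (\<forall>n. x n \<in> carrier (F n)) \<and> summable (\<lambda>n. lnorm (F n) (x n) powr p)},
     eq = (=),
     le = (\<lambda>x y. \<forall>n. le (F n) (x n) (y n)),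
     lnorm = (\<lambda>x. (\<Sum>n. lnorm (F n) (x n) powr p) powr (1 / p))\<rparr>"

definition c0_sum :: "(nat \<Rightarrow> 'f::real_vector normed_order) \<Rightarrow> (nat \<Rightarrow> 'f) normed_order" where
  "c0_sum F =
    \<lparr>carrier = {x. (\<forall>n. x n \<in> carrier (F n)) \<and> (\<lambda>n. lnorm (F n) (x n)) \<longlonglongrightarrow> 0},
     eq = (=),
     le = (\<lambda>x y. \<forall>n. le (F n) (x n) (y n)),
     lnorm = (\<lambda>x. SUP n. lnorm (F n) (x n))\<rparr>"

section \<open>Regular multilinear operators and Riesz multimorphisms\<close>

text \<open>
  A product of spaces \<open>E i\<close>, \<open>i \<in> I\<close>, consists of the extensional functions on \<open>I\<close>; for \<open>I = {}\<close> its
  only point is \<open>\<lambda>_. undefined\<close>.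
\<close>

abbreviation prod_space :: "nat set \<Rightarrow> (nat \<Rightarrow> ('e, 'b) gorder_scheme) \<Rightarrow> (nat \<Rightarrow> 'e) set" where
  "prod_space I E \<equiv> Pi\<^sub>E I (\<lambda>i. carrier (E i))"

definition multilinear ::
  "nat set \<Rightarrow> (nat \<Rightarrow> 'e::real_vector normed_order) \<Rightarrow> 'f::real_vector normed_order
    \<Rightarrow> ((nat \<Rightarrow> 'e) \<Rightarrow> 'f) \<Rightarrow> bool" where
  "multilinear I E F A \<longleftrightarrow>
    (\<forall>x\<in>prod_space I E. A x \<in> carrier F) \<and>
    (\<forall>x\<in>prod_space I E. \<forall>i\<in>I. \<forall>a\<in>carrier (E i). \<forall>b\<in>carrier (E i).
       A (x(i := a + b)) = A (x(i := a)) + A (x(i := b))) \<and>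
    (\<forall>x\<in>prod_space I E. \<forall>i\<in>I. \<forall>a\<in>carrier (E i). \<forall>c.
       A (x(i := c *\<^sub>R a)) = c *\<^sub>R A (x(i := a)))"

definition positive_multilinear ::
  "nat set \<Rightarrow> (nat \<Rightarrow> 'e::real_vector normed_order) \<Rightarrow> 'f::real_vector normed_order
    \<Rightarrow> ((nat \<Rightarrow> 'e) \<Rightarrow> 'f) \<Rightarrow> bool" where
  "positive_multilinear I E F A \<longleftrightarrow>
    multilinear I E F A \<and>
    (\<forall>x\<in>prod_space I E. (\<forall>i\<in>I. le (E i) 0 (x i)) \<longrightarrow> le F 0 (A x))"

definition regular_multilinear ::
  "nat set \<Rightarrow> (nat \<Rightarrow> 'e::real_vector normed_order) \<Rightarrow> 'f::real_vector normed_order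
    \<Rightarrow> ((nat \<Rightarrow> 'e) \<Rightarrow> 'f) \<Rightarrow> bool" where
  "regular_multilinear I E F A \<longleftrightarrow>
    (\<exists>P Q. positive_multilinear I E F P \<and> positive_multilinear I E F Q \<and>
      (\<forall>x\<in>prod_space I E. A x = P x - Q x))"

definition riesz_multimorphism ::
  "nat \<Rightarrow> (nat \<Rightarrow> 'e::real_vector normed_order) \<Rightarrow> 'f::real_vector normed_order
    \<Rightarrow> ((nat \<Rightarrow> 'e) \<Rightarrow> 'f) \<Rightarrow> bool" where
  "riesz_multimorphism m E F A \<longleftrightarrow>
    regular_multilinear {1..m} E F A \<and>
    (\<forall>x\<in>prod_space {1..m} E.
       modulus F (A x) = A (\<lambda>i\<in>{1..m}. modulus (E i) (x i)))"

section \<open>Aron-Berner extensions\<close>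

definition remaining :: "nat \<Rightarrow> (nat \<Rightarrow> nat) \<Rightarrow> nat \<Rightarrow> nat set" where
  "remaining m \<rho> k = {1..m} - \<rho> ` {1..k}"

text \<open>
  For \<open>z\<close> in the bidual of \<open>E (\<rho> k)\<close> and a regular form \<open>B\<close> on the product of the \<open>E i\<close> with
  \<open>i \<in> remaining m \<rho> (k - 1)\<close>, this is the form obtained by applying \<open>z\<close> in the variable \<open>\<rho> k\<close>.
\<close>

definition apply_bidual ::
  "nat \<Rightarrow> (nat \<Rightarrow> 'e::real_vector normed_order) \<Rightarrow> (nat \<Rightarrow> nat) \<Rightarrow> nat \<Rightarrow> (('e \<Rightarrow> real) \<Rightarrow> real)
    \<Rightarrow> ((nat \<Rightarrow> 'e) \<Rightarrow> real) \<Rightarrow> (nat \<Rightarrow> 'e) \<Rightarrow> real" where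
  "apply_bidual m E \<rho> k z B =
    (\<lambda>x\<in>prod_space (remaining m \<rho> k) E.
       z (\<lambda>t. if t \<in> carrier (E (\<rho> k)) then B (x(\<rho> k := t)) else 0))"

primrec apply_biduals ::
  "nat \<Rightarrow> (nat \<Rightarrow> 'e::real_vector normed_order) \<Rightarrow> (nat \<Rightarrow> nat) \<Rightarrow> (nat \<Rightarrow> ('e \<Rightarrow> real) \<Rightarrow> real)
    \<Rightarrow> nat \<Rightarrow> ((nat \<Rightarrow> 'e) \<Rightarrow> real) \<Rightarrow> (nat \<Rightarrow> 'e) \<Rightarrow> real" where
  "apply_biduals m E \<rho> z 0 B = B"
| "apply_biduals m E \<rho> z (Suc k) B =
    apply_bidual m E \<rho> (Suc k) (z (\<rho> (Suc k))) (apply_biduals m E \<rho> z k B)"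

text \<open>
  After all \<open>m\<close> steps one has a form in no variables, which is identified with its value at the
  only point \<open>\<lambda>_. undefined\<close> of the empty product.
\<close>

definition aron_berner ::
  "nat \<Rightarrow> (nat \<Rightarrow> 'e::real_vector normed_order) \<Rightarrow> 'f::real_vector normed_order \<Rightarrow> (nat \<Rightarrow> nat)
    \<Rightarrow> ((nat \<Rightarrow> 'e) \<Rightarrow> 'f) \<Rightarrow> (nat \<Rightarrow> ('e \<Rightarrow> real) \<Rightarrow> real) \<Rightarrow> ('f \<Rightarrow> real) \<Rightarrow> real" where
  "aron_berner m E F \<rho> A z =
    (\<lambda>y. if y \<in> carrier (dual_lattice F)
         then apply_biduals m E \<rho> z m (\<lambda>x\<in>prod_space {1..m} E. y (A x)) (\<lambda>_. undefined)
         else 0)"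

text \<open>
  All Aron-Berner extensions of any \<open>F\<close>-valued Riesz multimorphism are Riesz multimorphisms. The
  domains range over all Banach lattices carried by subspaces of the type \<open>'e\<close>; statements about
  all Banach lattices are polymorphic in \<open>'e\<close>.
\<close>

definition aron_berner_riesz :: "'e::real_vector itself \<Rightarrow> 'f::real_vector normed_order \<Rightarrow> bool" where
  "aron_berner_riesz TYPE('e) F \<longleftrightarrow>
    (\<forall>m\<ge>1. \<forall>(E :: nat \<Rightarrow> 'e normed_order) A \<rho>.
       (\<forall>i\<in>{1..m}. banach_lattice (E i)) \<and> riesz_multimorphism m E F A \<and> \<rho> permutes {1..m} \<longrightarrow>
       riesz_multimorphism m (\<lambda>i. bidual (E i)) (bidual F) (aron_berner m E F \<rho> A))"

end

(*
  A functional on the c0- or lp-sum G (1 < p) has small tails: otherwise it would be at least \<epsilon> on a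
  disjoint sequence in the unit ball, while the sum of K such elements has norm at most K^(1/p)
  (at most 1 for c0). Hence an element w of G** is determined by its coordinates w_n in F_n**, and
  the order of G** is the coordinatewise one. The n-th coordinate of the Aron-Berner extension of A
  is the extension of the n-th coordinate of A, which is again a Riesz multimorphism, so the
  modulus identity in G** holds because it holds in every F_n**.
*)

theory Submission
  imports Defs
begin

text \<open>The obstacle is that an element z of a bidual is linear only on the dual, and membership
  in the dual is a norm bound. So nothing can be said about an Aron-Berner extension until every
  functional to which some z is applied is known to be bounded. This is why a theorem on automatic
  boundedness of positive multilinear operators precedes the extension; it is the place where
  completeness of the domains is used.

  Small tails of a functional y mean that the partial sums built from its restrictions y_n to the
  F_n converge to y in norm, not only pointwise. Hence w(y) is the sum of all w_n(y_n) for w in G**,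
  and this formula is what makes order and equality in G** coordinatewise. The modulus of w is then
  recognised rather than constructed: it is enough to exhibit an element of G** whose n-th
  coordinate is the modulus of w_n. If w is the value of the extension at z, that element is the
  value at the moduli of the entries of z.\<close>

section \<open>Normed Riesz spaces\<close>

text \<open>A common framework for Banach lattices, their duals and their biduals. A modulus for
  each element replaces binary joins and meets; the infimum of x and y is recovered as (x + y - |x -
  y|)/2.\<close>

locale normed_riesz_space =
  fixes L :: "'a::real_vector normed_order" (structure)
  assumes subspace_carrier: "subspace (carrier L)"
    and le_refl: "x \<in> carrier L \<Longrightarrow> x \<sqsubseteq> x"
    and le_antisym: "\<lbrakk>x \<in> carrier L; y \<in> carrier L; x \<sqsubseteq> y; y \<sqsubseteq> x\<rbrakk> \<Longrightarrow> x = y"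
    and le_trans:
      "\<lbrakk>x \<in> carrier L; y \<in> carrier L; z \<in> carrier L; x \<sqsubseteq> y; y \<sqsubseteq> z\<rbrakk> \<Longrightarrow> x \<sqsubseteq> z"
    and add_right_mono:
      "\<lbrakk>x \<in> carrier L; y \<in> carrier L; z \<in> carrier L; x \<sqsubseteq> y\<rbrakk> \<Longrightarrow> x + z \<sqsubseteq> y + z"
    and scaleR_nonneg:
      "\<lbrakk>x \<in> carrier L; 0 \<sqsubseteq> x; 0 \<le> c\<rbrakk> \<Longrightarrow> 0 \<sqsubseteq> c *\<^sub>R x"
    and modulus_exists:
      "x \<in> carrier L \<Longrightarrow>
       \<exists>s\<in>carrier L. x \<sqsubseteq> s \<and> - x \<sqsubseteq> s \<and> (\<forall>u\<in>carrier L. x \<sqsubseteq> u \<longrightarrow> - x \<sqsubseteq> u \<longrightarrow> s \<sqsubseteq> u)"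
    and lnorm_eq_0_iff: "x \<in> carrier L \<Longrightarrow> lnorm L x = 0 \<longleftrightarrow> x = 0"
    and lnorm_triangle:
      "\<lbrakk>x \<in> carrier L; y \<in> carrier L\<rbrakk> \<Longrightarrow> lnorm L (x + y) \<le> lnorm L x + lnorm L y"
    and lnorm_scaleR: "x \<in> carrier L \<Longrightarrow> lnorm L (c *\<^sub>R x) = \<bar>c\<bar> * lnorm L x"
    and lnorm_mono:
      "\<lbrakk>x \<in> carrier L; y \<in> carrier L; modulus L x \<sqsubseteq> modulus L y\<rbrakk> \<Longrightarrow> lnorm L x \<le> lnorm L y"

definition pos_cone :: "'a::real_vector normed_order \<Rightarrow> 'a set" where
  "pos_cone L = {x \<in> carrier L. le L 0 x}"

text \<open>\<open>modulus\<close> selects a least upper bound by \<open>SOME\<close>, and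
  antisymmetry makes it unique. The hypotheses are elementary so that the rule can compute moduli in
  duals, sequence sums and biduals.\<close>

lemma modulus_eqI:
  assumes "x \<in> carrier L" "- x \<in> carrier L" "s \<in> carrier L"
    and "le L x s" "le L (- x) s"
    and "\<And>u. \<lbrakk>u \<in> carrier L; le L x u; le L (- x) u\<rbrakk> \<Longrightarrow> le L s u"
    and "\<And>u v. \<lbrakk>u \<in> carrier L; v \<in> carrier L; le L u v; le L v u\<rbrakk> \<Longrightarrow> u = v"
  shows "modulus L x = s"
proof -
  have "least L s (Upper L {x, - x})"
    using assms by (auto simp: least_def Upper_def)
  moreover have "t = s" if "least L t (Upper L {x, - x})" for t
    using that calculation assms(7) by (auto simp: least_def Upper_def)
  ultimately show ?thesis
    unfolding modulus_def join_def sup_def by (rule some_equality)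
qed

section \<open>Cone calculus, moduli and Riesz decomposition\<close>

context normed_riesz_space
begin

lemma carrier_add: "\<lbrakk>x \<in> carrier L; y \<in> carrier L\<rbrakk> \<Longrightarrow> x + y \<in> carrier L"
  and carrier_diff: "\<lbrakk>x \<in> carrier L; y \<in> carrier L\<rbrakk> \<Longrightarrow> x - y \<in> carrier L"
  and carrier_scaleR: "x \<in> carrier L \<Longrightarrow> c *\<^sub>R x \<in> carrier L"
  and carrier_minus: "x \<in> carrier L \<Longrightarrow> - x \<in> carrier L"
  and carrier_zero: "0 \<in> carrier L"
  using subspace_carrier
  by (auto intro: subspace_add subspace_diff subspace_scale subspace_neg subspace_0)

lemmas carrier_closed = carrier_add carrier_diff carrier_scaleR carrier_minus carrier_zero

lemma pos_in_carrier: "x \<in> pos_cone L \<Longrightarrow> x \<in> carrier L"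
  by (simp add: pos_cone_def)

text \<open>Turns inequalities into membership of differences in a cone that is closed under sums,
  so that they can be rearranged by \<open>algebra_simps\<close>.\<close>

lemma le_iff_pos:
  assumes "x \<in> carrier L" "y \<in> carrier L"
  shows "x \<sqsubseteq> y \<longleftrightarrow> y - x \<in> pos_cone L"
  using add_right_mono[of x y "- x"] add_right_mono[of 0 "y - x" x] assms
  by (auto simp: pos_cone_def carrier_closed)

lemma pos_zero: "0 \<in> pos_cone L"
  by (simp add: pos_cone_def le_refl carrier_zero)

lemma pos_scaleR: "x \<in> pos_cone L \<Longrightarrow> 0 \<le> c \<Longrightarrow> c *\<^sub>R x \<in> pos_cone L"
  by (simp add: pos_cone_def scaleR_nonneg carrier_closed)

lemma pos_add:
  assumes "x \<in> pos_cone L" "y \<in> pos_cone L"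
  shows "x + y \<in> pos_cone L"
  using assms add_right_mono[of 0 x y] le_trans[of 0 y "x + y"]
  by (auto simp: pos_cone_def carrier_closed)

lemma pos_sum: "(\<And>k. k \<in> S \<Longrightarrow> f k \<in> pos_cone L) \<Longrightarrow> sum f S \<in> pos_cone L"
  by (induction S rule: infinite_finite_induct) (auto intro: pos_zero pos_add)

lemma pos_antisym: "x \<in> pos_cone L \<Longrightarrow> - x \<in> pos_cone L \<Longrightarrow> x = 0"
  using le_antisym[of x 0] le_iff_pos[of x 0] by (auto simp: pos_cone_def carrier_closed)

lemma modulus_props:
  assumes "x \<in> carrier L"
  shows modulus_in_carrier: "modulus L x \<in> carrier L"
    and modulus_minus_pos: "modulus L x - x \<in> pos_cone L"
    and modulus_plus_pos: "modulus L x + x \<in> pos_cone L"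
    and modulus_least_pos:
      "\<lbrakk>u \<in> carrier L; u - x \<in> pos_cone L; u + x \<in> pos_cone L\<rbrakk> \<Longrightarrow> u - modulus L x \<in> pos_cone L"
proof -
  obtain s where s: "s \<in> carrier L" "x \<sqsubseteq> s" "- x \<sqsubseteq> s"
    "\<And>u. \<lbrakk>u \<in> carrier L; x \<sqsubseteq> u; - x \<sqsubseteq> u\<rbrakk> \<Longrightarrow> s \<sqsubseteq> u"
    using modulus_exists[OF assms] by blast
  then have m: "modulus L x = s"
    using assms by (intro modulus_eqI) (auto intro: le_antisym simp: carrier_closed)
  have c: "- x \<in> carrier L"
    using assms by (simp add: carrier_closed)
  show "modulus L x \<in> carrier L"
    "modulus L x - x \<in> pos_cone L" "modulus L x + x \<in> pos_cone L"
    using s m assms c by (auto simp: le_iff_pos)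
  show "u - modulus L x \<in> pos_cone L"
    if "u \<in> carrier L" "u - x \<in> pos_cone L" "u + x \<in> pos_cone L"
    using s(4)[of u] that m s(1) assms c by (simp add: le_iff_pos)
qed

text \<open>Formulas that express lattice operations by the modulus produce doubled elements; this
  removes the factor 2.\<close>

lemma pos_half:
  assumes "x + x \<in> pos_cone L"
  shows "x \<in> pos_cone L"
  using pos_scaleR[OF assms, of "1 / 2"] by (simp flip: scaleR_2)

lemma modulus_pos: "x \<in> carrier L \<Longrightarrow> modulus L x \<in> pos_cone L"
  using pos_add[OF modulus_minus_pos modulus_plus_pos, of x x] by - (rule pos_half[of "modulus L x"], simp)

lemma modulus_of_pos:
  assumes "x \<in> pos_cone L"
  shows "modulus L x = x"
proof (rule modulus_eqI)
  have c: "x \<in> carrier L" "- x \<in> carrier L"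
    using assms by (auto simp: carrier_closed pos_in_carrier)
  then show "x \<in> carrier L" "- x \<in> carrier L" "x \<in> carrier L" "x \<sqsubseteq> x"
    by (auto intro: le_refl)
  show "- x \<sqsubseteq> x"
    using c pos_add[OF assms assms] by (simp add: le_iff_pos)
qed (auto intro: le_antisym)

lemma modulus_modulus: "x \<in> carrier L \<Longrightarrow> modulus L (modulus L x) = modulus L x"
  by (simp add: modulus_of_pos modulus_pos)

lemma lnorm_modulus:
  assumes "x \<in> carrier L"
  shows "lnorm L (modulus L x) = lnorm L x"
  using assms
  by (intro antisym lnorm_mono) (auto simp: modulus_modulus modulus_in_carrier intro: le_refl)

lemma lnorm_dominated:
  assumes "x \<in> carrier L" "y \<in> carrier L" "y - x \<in> pos_cone L" "y + x \<in> pos_cone L"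
  shows "lnorm L x \<le> lnorm L y"
proof -
  have "y \<in> pos_cone L"
    using pos_add[OF assms(3,4)] by - (rule pos_half[of y], simp)
  then have "modulus L x \<sqsubseteq> modulus L y"
    using modulus_least_pos[OF assms(1,2,3,4)] assms
    by (simp add: le_iff_pos modulus_in_carrier modulus_of_pos)
  then show ?thesis
    using assms by (simp add: lnorm_mono)
qed

lemma lnorm_pos_mono:
  assumes "x \<in> pos_cone L" "y \<in> carrier L" "x \<sqsubseteq> y"
  shows "lnorm L x \<le> lnorm L y"
proof -
  have p: "y - x \<in> pos_cone L"
    using assms by (simp add: le_iff_pos pos_in_carrier)
  then have "y - x + (x + x) \<in> pos_cone L"
    using assms by (intro pos_add)
  then show ?thesis
    using assms p by (intro lnorm_dominated) (auto simp: pos_in_carrier)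
qed

lemma lnorm_zero: "lnorm L 0 = 0"
  by (simp add: lnorm_eq_0_iff carrier_zero)

lemma lnorm_minus: "x \<in> carrier L \<Longrightarrow> lnorm L (- x) = lnorm L x"
  using lnorm_scaleR[of x "- 1"] by simp

lemma lnorm_nonneg: "x \<in> carrier L \<Longrightarrow> 0 \<le> lnorm L x"
  using lnorm_triangle[of x "- x"] by (simp add: lnorm_zero lnorm_minus carrier_closed)

text \<open>The positive and negative parts are \<open>(\<bar>x\<bar> \<plusminus> x) / 2\<close>.\<close>

lemma pos_decomposition:
  assumes "x \<in> carrier L"
  obtains a b where "a \<in> pos_cone L" "b \<in> pos_cone L" "x = a - b" "modulus L x = a + b"
proof
  show "(1 / 2) *\<^sub>R (modulus L x + x) \<in> pos_cone L" "(1 / 2) *\<^sub>R (modulus L x - x) \<in> pos_cone L"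
    using assms by (auto intro: pos_scaleR modulus_minus_pos modulus_plus_pos)
  have "(1/2) *\<^sub>R x + (1/2) *\<^sub>R x = x" "(1/2) *\<^sub>R modulus L x + (1/2) *\<^sub>R modulus L x = modulus L x"
    by (simp_all flip: scaleR_add_left)
  then show "x = (1 / 2) *\<^sub>R (modulus L x + x) - (1 / 2) *\<^sub>R (modulus L x - x)"
    "modulus L x = (1 / 2) *\<^sub>R (modulus L x + x) + (1 / 2) *\<^sub>R (modulus L x - x)"
    by (simp_all add: algebra_simps)
qed

text \<open>The witness a is the infimum of v and x, in the form (v + x - |v - x|)/2. The claims
  about it are checked after doubling, with |v - x| bounded by something above both v - x and x -
  v.\<close>

lemma riesz_decomposition_pos:
  assumes v: "v \<in> pos_cone L" and x: "x \<in> pos_cone L" and y: "y \<in> pos_cone L"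
    and le: "x + y - v \<in> pos_cone L"
  obtains a b where "a \<in> pos_cone L" "b \<in> pos_cone L" "v = a + b"
    "x - a \<in> pos_cone L" "y - b \<in> pos_cone L"
proof
  define w where "w = modulus L (v - x)"
  define a where "a = (1 / 2) *\<^sub>R (v + x - w)"
  have c: "v - x \<in> carrier L" "v \<in> carrier L" "x \<in> carrier L" "y \<in> carrier L"
    using v x y by (auto simp: carrier_closed pos_in_carrier)
  have w: "w - (v - x) \<in> pos_cone L" "w + (v - x) \<in> pos_cone L"
    "\<And>u. \<lbrakk>u \<in> carrier L; u - (v - x) \<in> pos_cone L; u + (v - x) \<in> pos_cone L\<rbrakk> \<Longrightarrow> u - w \<in> pos_cone L"
    using modulus_props[OF c(1)] by (auto simp: w_def)
  have aa: "a + a = v + x - w"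
    by (simp add: a_def flip: scaleR_add_left)
  have "v + x - w \<in> pos_cone L"
    using pos_add[OF v v] pos_add[OF x x] c
    by (intro w(3)) (auto simp: algebra_simps carrier_closed)
  then show "a \<in> pos_cone L"
    by (simp add: a_def pos_scaleR)
  have 1: "(v - a) + (v - a) = w + (v - x)"
    using aa by (simp add: algebra_simps)
  show "v - a \<in> pos_cone L"
    by (rule pos_half) (simp only: 1 w)
  have 2: "(x - a) + (x - a) = w - (v - x)"
    using aa by (simp add: algebra_simps)
  show "x - a \<in> pos_cone L"
    by (rule pos_half) (simp only: 2 w)
  \<comment> \<open>The inequality v <= x + y makes 2y - v + x an upper bound of v - x, and y >= 0
    makes it an upper bound of x - v.\<close>
  have "(y + y - v + x) - w \<in> pos_cone L"
    using pos_add[OF le le] pos_add[OF y y] c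
    by (intro w(3)) (auto simp: algebra_simps carrier_closed)
  moreover have 3: "(y - (v - a)) + (y - (v - a)) = (y + y - v + x) - w"
    using aa by (simp add: algebra_simps)
  ultimately show "y - (v - a) \<in> pos_cone L"
    by - (rule pos_half[of "y - (v - a)"], simp only: 3)
qed simp

text \<open>The shifted element u + x + y lies between 0 and 2x + 2y; its positive decomposition is
  shifted back by x and y. The symmetric form is what additivity of x -> sup {f u : |u| <= x} calls
  for.\<close>

lemma riesz_decomposition:
  assumes x: "x \<in> pos_cone L" and y: "y \<in> pos_cone L"
    and u: "x + y - u \<in> pos_cone L" "x + y + u \<in> pos_cone L"
  obtains a b where "u = a + b" "a \<in> carrier L" "b \<in> carrier L"
    "x - a \<in> pos_cone L" "x + a \<in> pos_cone L" "y - b \<in> pos_cone L" "y + b \<in> pos_cone L"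
proof -
  have "x + x + (y + y) - (x + y + u) = x + y - u"
    by (simp add: algebra_simps)
  then obtain a b where "a \<in> pos_cone L" "b \<in> pos_cone L" "x + y + u = a + b"
    "x + x - a \<in> pos_cone L" "y + y - b \<in> pos_cone L"
    using riesz_decomposition_pos[of "x + y + u" "x + x" "y + y"] u pos_add x y by metis
  then show ?thesis
    using x y
    by (intro that[of "a - x" "b - y"]) (auto simp: algebra_simps carrier_closed pos_in_carrier)
qed

text \<open>Kantorovich's extension, q of the positive part minus q of the negative part. Any other
  decomposition gives the same value, because s - t = a - b means s + b = a + t among positive
  elements. The bound passes from the cone to all x by |g x| <= q |x|, as |x| has the norm of
  x.\<close>

lemma positive_linear_extension:
  assumes add: "\<And>x y. \<lbrakk>x \<in> pos_cone L; y \<in> pos_cone L\<rbrakk> \<Longrightarrow> q (x + y) = q x + q y"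
    and scale: "\<And>c x. \<lbrakk>x \<in> pos_cone L; 0 \<le> c\<rbrakk> \<Longrightarrow> q (c *\<^sub>R x) = c * q x"
    and bound: "\<And>x. x \<in> pos_cone L \<Longrightarrow> \<bar>q x\<bar> \<le> K * lnorm L x"
    and nonneg: "\<And>x. x \<in> pos_cone L \<Longrightarrow> 0 \<le> q x"
  obtains g where "g \<in> carrier (dual_lattice L)" "\<And>x. x \<in> pos_cone L \<Longrightarrow> g x = q x"
proof -
  define g where "g x =
    (if x \<in> carrier L then q ((1/2) *\<^sub>R (modulus L x + x)) - q ((1/2) *\<^sub>R (modulus L x - x)) else 0)"
    for x
  have g: "g (a - b) = q a - q b" if "a \<in> pos_cone L" "b \<in> pos_cone L" for a b
  proof -
    have c: "a - b \<in> carrier L"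
      using that by (auto simp: carrier_closed pos_in_carrier)
    define s t where "s = (1/2) *\<^sub>R (modulus L (a - b) + (a - b))"
      and "t = (1/2) *\<^sub>R (modulus L (a - b) - (a - b))"
    have st: "s \<in> pos_cone L" "t \<in> pos_cone L"
      using c by (auto simp: s_def t_def intro: pos_scaleR modulus_minus_pos modulus_plus_pos)
    have "s - t = (1/2) *\<^sub>R (a - b) + (1/2) *\<^sub>R (a - b)"
      by (simp add: s_def t_def algebra_simps)
    also have "\<dots> = a - b"
      by (simp flip: scaleR_add_left)
    finally have "s + b = a + t"
      by (simp add: algebra_simps)
    then have "q s + q b = q a + q t"
      using add st that by metis
    then show ?thesis
      using c by (simp add: g_def flip: s_def t_def)
  qed
  have gq: "g x = q x" if "x \<in> pos_cone L" for x
    using g[OF that pos_zero] scale[OF pos_zero, of 0] by simp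
  have addg: "g (x + y) = g x + g y" if xy: "x \<in> carrier L" "y \<in> carrier L" for x y
  proof -
    obtain a b where ab: "a \<in> pos_cone L" "b \<in> pos_cone L" "x = a - b"
      using pos_decomposition[OF xy(1)] by metis
    obtain c d where cd: "c \<in> pos_cone L" "d \<in> pos_cone L" "y = c - d"
      using pos_decomposition[OF xy(2)] by metis
    have "x + y = (a + c) - (b + d)"
      using ab cd by simp
    then show ?thesis
      using ab cd g[of "a + c" "b + d"] pos_add add by (simp only: g)
  qed
  have scaleg: "g (c *\<^sub>R x) = c * g x" if x: "x \<in> carrier L" for c x
  proof -
    obtain a b where ab: "a \<in> pos_cone L" "b \<in> pos_cone L" "x = a - b"
      using pos_decomposition[OF x] by metis
    show ?thesis
    proof (cases "0 \<le> c")
      case True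
      then show ?thesis
        using ab g[of "c *\<^sub>R a" "c *\<^sub>R b"] g[of a b]
      by (simp add: pos_scaleR scale scaleR_diff_right right_diff_distrib)
    next
      case False
      \<comment> \<open>A negative factor interchanges the roles of the two positive
        summands.\<close>
      have 1: "c *\<^sub>R x = (- c) *\<^sub>R b - (- c) *\<^sub>R a"
        using ab by (simp add: scaleR_diff_right)
      have "g (c *\<^sub>R x) = (- c) * q b - (- c) * q a"
        unfolding 1 using False ab g[of "(- c) *\<^sub>R b" "(- c) *\<^sub>R a"] pos_scaleR[of a "- c"]
          pos_scaleR[of b "- c"] scale[of a "- c"] scale[of b "- c"]
        by simp
      then show ?thesis
        using ab by (simp add: g right_diff_distrib)
    qed
  qed
  have "\<bar>g x\<bar> \<le> K * lnorm L x" if x: "x \<in> carrier L" for x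
  proof -
    obtain a b where ab: "a \<in> pos_cone L" "b \<in> pos_cone L" "x = a - b" "modulus L x = a + b"
      using pos_decomposition[OF x] by metis
    have "\<bar>g x\<bar> \<le> q (modulus L x)"
      using ab add nonneg[of a] nonneg[of b] by (simp add: g)
    also have "\<dots> \<le> K * lnorm L (modulus L x)"
      using bound[of "modulus L x"] modulus_pos[OF x] by (simp add: abs_le_iff)
    finally show ?thesis
      using x by (simp add: lnorm_modulus)
  qed
  then have "g \<in> carrier (dual_lattice L)"
    using addg scaleg by (auto simp: dual_lattice_def g_def)
  then show ?thesis
    using gq that by blast
qed

end

lemma (in banach_lattice) normed_riesz: "normed_riesz_space L"
proof
  fix x assume x: "x \<in> carrier L"
  have mx: "- x \<in> carrier L"
    using subspace_carrier x by (rule subspace_neg)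
  show "\<exists>s\<in>carrier L. x \<sqsubseteq> s \<and> - x \<sqsubseteq> s \<and> (\<forall>u\<in>carrier L. x \<sqsubseteq> u \<longrightarrow> - x \<sqsubseteq> u \<longrightarrow> s \<sqsubseteq> u)"
    using x mx join_left[OF x mx] join_right[OF x mx] join_closed[OF x mx] join_le
    by blast
  fix y assume y: "y \<in> carrier L"
  show "x \<sqsubseteq> y \<Longrightarrow> y \<sqsubseteq> x \<Longrightarrow> x = y"
    by (rule le_antisym[OF _ _ x y])
  show "z \<in> carrier L \<Longrightarrow> x \<sqsubseteq> y \<Longrightarrow> y \<sqsubseteq> z \<Longrightarrow> x \<sqsubseteq> z" for z
    by (rule le_trans[OF _ _ x y])
qed (fact subspace_carrier le_refl add_right_mono scaleR_nonneg lnorm_eq_0_iff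
      lnorm_triangle lnorm_scaleR lnorm_mono)+

section \<open>Duals\<close>

lemma dual_iff:
  "f \<in> carrier (dual_lattice L) \<longleftrightarrow>
    (\<forall>x\<in>carrier L. \<forall>y\<in>carrier L. f (x + y) = f x + f y) \<and>
    (\<forall>c. \<forall>x\<in>carrier L. f (c *\<^sub>R x) = c * f x) \<and>
    (\<exists>K. \<forall>x\<in>carrier L. \<bar>f x\<bar> \<le> K * lnorm L x) \<and>
    (\<forall>x. x \<notin> carrier L \<longrightarrow> f x = 0)"
  by (simp add: dual_lattice_def)

lemma dual_le_iff: "le (dual_lattice L) f g \<longleftrightarrow> (\<forall>x\<in>pos_cone L. f x \<le> g x)"
  by (auto simp: dual_lattice_def pos_cone_def)

lemma dual_add: "\<lbrakk>f \<in> carrier (dual_lattice L); x \<in> carrier L; y \<in> carrier L\<rbrakk> \<Longrightarrow> f (x + y) = f x + f y"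
  and dual_scaleR: "\<lbrakk>f \<in> carrier (dual_lattice L); x \<in> carrier L\<rbrakk> \<Longrightarrow> f (c *\<^sub>R x) = c * f x"
  and dual_outside: "\<lbrakk>f \<in> carrier (dual_lattice L); x \<notin> carrier L\<rbrakk> \<Longrightarrow> f x = 0"
  by (auto simp: dual_iff)

lemma dual_minus: "\<lbrakk>f \<in> carrier (dual_lattice L); x \<in> carrier L\<rbrakk> \<Longrightarrow> f (- x) = - f x"
  using dual_scaleR[of f L x "- 1"] by simp

lemma dual_diff:
  "\<lbrakk>f \<in> carrier (dual_lattice L); x \<in> carrier L; y \<in> carrier L; - y \<in> carrier L\<rbrakk>
    \<Longrightarrow> f (x - y) = f x - f y"
  using dual_add[of f L x "- y"] by (simp add: dual_minus)

lemma dual_zero: "\<lbrakk>f \<in> carrier (dual_lattice L); 0 \<in> carrier L\<rbrakk> \<Longrightarrow> f 0 = 0"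
  using dual_scaleR[of f L 0 0] by simp

lemma subspace_dual: "subspace (carrier (dual_lattice L))"
proof (rule subspaceI)
  show "0 \<in> carrier (dual_lattice L)"
    by (auto simp: dual_iff intro: exI[of _ 0])
next
  fix f g assume fg: "f \<in> carrier (dual_lattice L)" "g \<in> carrier (dual_lattice L)"
  then obtain K M where "\<forall>x\<in>carrier L. \<bar>f x\<bar> \<le> K * lnorm L x" "\<forall>x\<in>carrier L. \<bar>g x\<bar> \<le> M * lnorm L x"
    unfolding dual_iff by blast
  then have "\<forall>x\<in>carrier L. \<bar>f x + g x\<bar> \<le> (K + M) * lnorm L x"
    by (fastforce simp: distrib_right)
  then show "f + g \<in> carrier (dual_lattice L)"
    using fg unfolding dual_iff by (auto simp: distrib_left)
next
  fix c f assume f: "f \<in> carrier (dual_lattice L)"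
  then obtain K where "\<forall>x\<in>carrier L. \<bar>f x\<bar> \<le> K * lnorm L x"
    unfolding dual_iff by blast
  then have "\<forall>x\<in>carrier L. \<bar>c * f x\<bar> \<le> (\<bar>c\<bar> * K) * lnorm L x"
    by (simp add: abs_mult mult_left_mono mult.assoc)
  then show "c *\<^sub>R f \<in> carrier (dual_lattice L)"
    using f unfolding dual_iff by (auto simp: scaleR_fun_def distrib_left mult.left_commute)
qed

text \<open>What the estimates for the dual norm rely on. The sequence sums extend this locale by
  coordinatewise properties, so the estimates serve them and normed Riesz spaces alike.\<close>

locale homogeneous_norm =
  fixes L :: "'a::real_vector normed_order"
  assumes zero_closed: "0 \<in> carrier L"
    and scaleR_closed: "x \<in> carrier L \<Longrightarrow> c *\<^sub>R x \<in> carrier L"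
    and lnorm_homogeneous: "x \<in> carrier L \<Longrightarrow> lnorm L (c *\<^sub>R x) = \<bar>c\<bar> * lnorm L x"
    and lnorm_ge_0: "x \<in> carrier L \<Longrightarrow> 0 \<le> lnorm L x"
begin

lemma lnorm_of_zero: "lnorm L 0 = 0"
  using lnorm_homogeneous[OF zero_closed, of 0] by simp

lemma dual_bdd:
  assumes "f \<in> carrier (dual_lattice L)"
  shows "bdd_above ((\<lambda>x. \<bar>f x\<bar>) ` {x \<in> carrier L. lnorm L x \<le> 1})"
proof -
  obtain K where K: "\<forall>x\<in>carrier L. \<bar>f x\<bar> \<le> K * lnorm L x"
    using assms unfolding dual_iff by blast
  have "\<bar>f x\<bar> \<le> \<bar>K\<bar>" if "x \<in> carrier L" "lnorm L x \<le> 1" for x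
  proof -
    have "\<bar>f x\<bar> \<le> K * lnorm L x"
      using K that by blast
    also have "\<dots> \<le> \<bar>K\<bar> * 1"
      using that lnorm_ge_0[of x] by (intro mult_mono) auto
    finally show ?thesis by simp
  qed
  then show ?thesis
    by (intro bdd_aboveI2[where M = "\<bar>K\<bar>"]) auto
qed

lemma dual_norm_upper:
  assumes "f \<in> carrier (dual_lattice L)" "x \<in> carrier L" "lnorm L x \<le> 1"
  shows "\<bar>f x\<bar> \<le> lnorm (dual_lattice L) f"
  unfolding dual_lattice_def using assms
  by (auto intro!: cSUP_upper[OF _ dual_bdd])

lemma dual_norm_nonneg:
  assumes "f \<in> carrier (dual_lattice L)"
  shows "0 \<le> lnorm (dual_lattice L) f"
  using dual_norm_upper[OF assms zero_closed] by (simp add: lnorm_of_zero)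

lemma dual_norm_bound:
  assumes f: "f \<in> carrier (dual_lattice L)" and x: "x \<in> carrier L"
  shows "\<bar>f x\<bar> \<le> lnorm (dual_lattice L) f * lnorm L x"
proof (cases "lnorm L x = 0")
  case True
  \<comment> \<open>Where the norm vanishes, x cannot be normalised; there f vanishes by the bound
    that membership in the dual provides.\<close>
  obtain K where "\<forall>x\<in>carrier L. \<bar>f x\<bar> \<le> K * lnorm L x"
    using f unfolding dual_iff by blast
  then have "\<bar>f x\<bar> \<le> K * lnorm L x"
    using x by blast
  then show ?thesis
    using True by simp
next
  case False
  then have pos: "0 < lnorm L x"
    using lnorm_ge_0[OF x] by simp
  have "\<bar>f ((1 / lnorm L x) *\<^sub>R x)\<bar> \<le> lnorm (dual_lattice L) f"
    using f x pos by (intro dual_norm_upper) (auto simp: scaleR_closed lnorm_homogeneous)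
  then show ?thesis
    using pos dual_scaleR[OF f x, of "1 / lnorm L x"] by (simp add: field_simps)
qed

lemma dual_norm_le:
  assumes "0 \<le> K" "\<And>x. \<lbrakk>x \<in> carrier L; lnorm L x \<le> 1\<rbrakk> \<Longrightarrow> \<bar>f x\<bar> \<le> K"
  shows "lnorm (dual_lattice L) f \<le> K"
  unfolding dual_lattice_def using assms zero_closed lnorm_of_zero
  by (auto intro!: cSUP_least)

end

sublocale normed_riesz_space \<subseteq> homogeneous_norm L
  by unfold_locales (auto simp: carrier_closed lnorm_scaleR lnorm_nonneg)

context normed_riesz_space
begin

lemma dual_eqI:
  assumes f: "f \<in> carrier (dual_lattice L)" and g: "g \<in> carrier (dual_lattice L)"
    and eq: "\<And>x. x \<in> pos_cone L \<Longrightarrow> f x = g x"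
  shows "f = g"
proof
  fix x
  show "f x = g x"
  proof (cases "x \<in> carrier L")
    case True
    then obtain a b where ab: "a \<in> pos_cone L" "b \<in> pos_cone L" "x = a - b"
      using pos_decomposition by metis
    then show ?thesis
      using dual_diff[OF f, of a b] dual_diff[OF g, of a b] eq
      by (simp add: carrier_closed pos_in_carrier)
  qed (use f g in \<open>simp add: dual_outside\<close>)
qed

lemma dual_antisym:
  assumes "f \<in> carrier (dual_lattice L)" "g \<in> carrier (dual_lattice L)"
    "le (dual_lattice L) f g" "le (dual_lattice L) g f"
  shows "f = g"
  using assms by (intro dual_eqI) (auto simp: dual_le_iff intro: antisym)

text \<open>Riesz--Kantorovich: \<open>\<bar>f\<bar>(x) = sup {f u | \<bar>u\<bar> \<le> x}\<close>.\<close>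

lemma riesz_kantorovich:
  assumes f: "f \<in> carrier (dual_lattice L)"
  obtains g where "g \<in> carrier (dual_lattice L)"
    "\<And>u x. \<lbrakk>u \<in> carrier L; x - u \<in> pos_cone L; x + u \<in> pos_cone L\<rbrakk> \<Longrightarrow> f u \<le> g x"
    "\<And>x c. \<lbrakk>x \<in> pos_cone L;
      \<And>u. \<lbrakk>u \<in> carrier L; x - u \<in> pos_cone L; x + u \<in> pos_cone L\<rbrakk> \<Longrightarrow> f u \<le> c\<rbrakk> \<Longrightarrow> g x \<le> c"
proof -
  define S where "S x = {u \<in> carrier L. x - u \<in> pos_cone L \<and> x + u \<in> pos_cone L}" for x
  define q where "q x = Sup (f ` S x)" for x
  let ?K = "lnorm (dual_lattice L) f"
  have S0: "0 \<in> S x" if "x \<in> pos_cone L" for x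
    using that by (simp add: S_def carrier_closed)
  have Sm: "- u \<in> S x" if "u \<in> S x" for u x
    using that by (simp add: S_def carrier_closed)
  have Spos: "x \<in> pos_cone L" if "u \<in> S x" for u x
    using that pos_add[of "x - u" "x + u"] by (intro pos_half[of x]) (simp add: S_def)
  have bound: "f u \<le> ?K * lnorm L x" if u: "u \<in> S x" for u x
  proof -
    have "x \<in> carrier L"
      using Spos[OF u] by (rule pos_in_carrier)
    then have "lnorm L u \<le> lnorm L x"
      using u by (intro lnorm_dominated) (auto simp: S_def)
    moreover have "\<bar>f u\<bar> \<le> ?K * lnorm L u"
      using f u by (intro dual_norm_bound) (auto simp: S_def)
    ultimately show ?thesis
      using dual_norm_nonneg[OF f] mult_left_mono[of "lnorm L u" "lnorm L x" ?K] by linarith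
  qed
  have bdd: "bdd_above (f ` S x)" for x
    using bound by (intro bdd_aboveI2) blast
  have upper: "f u \<le> q x" if "u \<in> S x" for u x
    unfolding q_def using that bdd by (intro cSUP_upper) auto
  have least: "q x \<le> c" if "x \<in> pos_cone L" "\<And>u. u \<in> S x \<Longrightarrow> f u \<le> c" for x c
    unfolding q_def using that S0 by (intro cSUP_least) auto
  have nonneg: "0 \<le> q x" if "x \<in> pos_cone L" for x
    using upper[OF S0[OF that]] dual_zero[OF f carrier_zero] by simp
  have add: "q (x + y) = q x + q y" if x: "x \<in> pos_cone L" and y: "y \<in> pos_cone L" for x y
  proof (rule antisym)
    show "q (x + y) \<le> q x + q y"
    proof (rule least)
      fix u assume "u \<in> S (x + y)"
      then obtain a b where "u = a + b" "a \<in> S x" "b \<in> S y"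
        using riesz_decomposition[OF x y, of u] unfolding S_def by blast
      then show "f u \<le> q x + q y"
        using dual_add[OF f, of a b] upper[of a x] upper[of b y] by (simp add: S_def)
    qed (simp add: x y pos_add)
    have *: "f a + f b \<le> q (x + y)" if "a \<in> S x" "b \<in> S y" for a b
    proof -
      have "x - a + (y - b) \<in> pos_cone L" "x + a + (y + b) \<in> pos_cone L"
        using that by (auto simp: S_def intro!: pos_add)
      then have "a + b \<in> S (x + y)"
        using that by (simp add: S_def carrier_closed algebra_simps)
      then show ?thesis
        using upper dual_add[OF f, of a b] that by (fastforce simp: S_def)
    qed
    \<comment> \<open>The supremum over pairs is taken one variable at a time: over b with a fixed,
      then over a.\<close>
    have "f a \<le> q (x + y) - q y" if "a \<in> S x" for a
    proof -
      have "q y \<le> q (x + y) - f a"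
        using *[OF that] by (intro least[OF y]) (simp add: algebra_simps)
      then show ?thesis by simp
    qed
    then have "q x \<le> q (x + y) - q y"
      by (rule least[OF x])
    then show "q x + q y \<le> q (x + y)" by simp
  qed
  have scale_le: "c * q x \<le> q (c *\<^sub>R x)" if x: "x \<in> pos_cone L" and c: "0 < c" for c x
  proof -
    have "f u \<le> q (c *\<^sub>R x) / c" if u: "u \<in> S x" for u
    proof -
      have "c *\<^sub>R u \<in> S (c *\<^sub>R x)"
        using u c pos_scaleR[of "x - u" c] pos_scaleR[of "x + u" c]
        by (simp add: S_def carrier_closed algebra_simps)
      then show ?thesis
        using upper dual_scaleR[OF f, of u c] u c by (fastforce simp: S_def field_simps)
    qed
    then have "q x \<le> q (c *\<^sub>R x) / c"
      by (rule least[OF x])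
    then show ?thesis
      using c by (simp add: field_simps)
  qed
  have scale: "q (c *\<^sub>R x) = c * q x" if x: "x \<in> pos_cone L" and c: "0 \<le> c" for c x
  proof (cases "c = 0")
    case True
    have "q 0 \<le> 0"
    proof (rule least[OF pos_zero])
      fix u assume "u \<in> S 0"
      then have "u = 0"
        using pos_antisym[of u] by (simp add: S_def)
      then show "f u \<le> 0"
        using dual_zero[OF f carrier_zero] by simp
    qed
    then show ?thesis
      using True nonneg[OF pos_zero] by simp
  next
    case False
    then have c: "0 < c" using c by simp
    \<comment> \<open>The reverse inequality is \<open>scale_le\<close> for the element c x and the
      factor 1/c.\<close>
    show ?thesis
      using scale_le[OF x c] scale_le[of "c *\<^sub>R x" "1 / c"] x c
      by (intro antisym) (auto simp: field_simps pos_scaleR)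
  qed
  have qbound: "\<bar>q x\<bar> \<le> ?K * lnorm L x" if "x \<in> pos_cone L" for x
    using nonneg[OF that] least[OF that bound] by simp
  obtain g where g: "g \<in> carrier (dual_lattice L)" "\<And>x. x \<in> pos_cone L \<Longrightarrow> g x = q x"
    using positive_linear_extension[of q ?K, OF add scale qbound nonneg] by blast
  have "f u \<le> g x" if "u \<in> carrier L" "x - u \<in> pos_cone L" "x + u \<in> pos_cone L" for u x
  proof -
    have "u \<in> S x"
      using that by (simp add: S_def)
    then show ?thesis
      using upper g(2) Spos by simp
  qed
  moreover have "g x \<le> c"
    if "x \<in> pos_cone L"
      "\<And>u. \<lbrakk>u \<in> carrier L; x - u \<in> pos_cone L; x + u \<in> pos_cone L\<rbrakk> \<Longrightarrow> f u \<le> c" for x c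
    using that g(2) least[OF that(1), of c] by (simp add: S_def)
  ultimately show ?thesis
    using g(1) that by blast
qed

text \<open>The Riesz-Kantorovich functional is the least upper bound: if h dominates f and -f, and
  u = a - b with |u| = a + b <= x, then f u = f a - f b <= h a + h b = h |u| <= h x. The last clause
  keeps the supremum formula, on which monotonicity of the dual norm rests.\<close>

lemma dual_modulus_exists:
  assumes f: "f \<in> carrier (dual_lattice L)"
  obtains g where "g \<in> carrier (dual_lattice L)"
    "le (dual_lattice L) f g" "le (dual_lattice L) (- f) g"
    "\<And>h. \<lbrakk>h \<in> carrier (dual_lattice L); le (dual_lattice L) f h; le (dual_lattice L) (- f) h\<rbrakk>
      \<Longrightarrow> le (dual_lattice L) g h"
    "\<And>x c. \<lbrakk>x \<in> pos_cone L;
      \<And>u. \<lbrakk>u \<in> carrier L; x - u \<in> pos_cone L; x + u \<in> pos_cone L\<rbrakk> \<Longrightarrow> f u \<le> c\<rbrakk> \<Longrightarrow> g x \<le> c"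
proof -
  obtain g where g: "g \<in> carrier (dual_lattice L)"
    "\<And>u x. \<lbrakk>u \<in> carrier L; x - u \<in> pos_cone L; x + u \<in> pos_cone L\<rbrakk> \<Longrightarrow> f u \<le> g x"
    "\<And>x c. \<lbrakk>x \<in> pos_cone L;
      \<And>u. \<lbrakk>u \<in> carrier L; x - u \<in> pos_cone L; x + u \<in> pos_cone L\<rbrakk> \<Longrightarrow> f u \<le> c\<rbrakk> \<Longrightarrow> g x \<le> c"
    using riesz_kantorovich[OF f] by metis
  show ?thesis
  proof (rule that[OF g(1)])
    have "f x \<le> g x" "f (- x) \<le> g x" if "x \<in> pos_cone L" for x
      using that pos_add[OF that that] pos_zero by (auto intro!: g(2) simp: carrier_closed pos_in_carrier)
    then show "le (dual_lattice L) f g" "le (dual_lattice L) (- f) g"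
      using dual_minus[OF f] by (auto simp: dual_le_iff pos_in_carrier)
  next
    fix h assume h: "h \<in> carrier (dual_lattice L)" "le (dual_lattice L) f h" "le (dual_lattice L) (- f) h"
    have "g x \<le> h x" if x: "x \<in> pos_cone L" for x
    proof (rule g(3)[OF x])
      fix u assume u: "u \<in> carrier L" "x - u \<in> pos_cone L" "x + u \<in> pos_cone L"
      obtain a b where ab: "a \<in> pos_cone L" "b \<in> pos_cone L" "u = a - b" "modulus L u = a + b"
        using pos_decomposition[OF u(1)] by metis
      have c: "x \<in> carrier L" "a \<in> carrier L" "b \<in> carrier L" "modulus L u \<in> carrier L"
        "x - modulus L u \<in> carrier L"
        using x ab u(1) by (auto simp: carrier_closed pos_in_carrier modulus_in_carrier)
      have 1: "x - modulus L u \<in> pos_cone L"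
        using c u by (intro modulus_least_pos)
      have "0 \<le> h y" if "y \<in> pos_cone L" for y
        using h(2,3) that by (force simp: dual_le_iff)
      then have "0 \<le> h (x - modulus L u)"
        using 1 by blast
      then have "h (modulus L u) \<le> h x"
        using dual_diff[OF h(1), of x "modulus L u"] c by (simp add: carrier_closed)
      moreover have "f u = f a - f b" "h (modulus L u) = h a + h b"
        using ab c dual_diff[OF f, of a b] dual_add[OF h(1), of a b] by (auto simp: carrier_closed)
      moreover have "f a \<le> h a" "- f b \<le> h b"
        using h(2,3) ab by (auto simp: dual_le_iff)
      ultimately show "f u \<le> h x" by linarith
    qed
    then show "le (dual_lattice L) g h"
      by (simp add: dual_le_iff)
  qed (use g in blast)
qed

lemma
  assumes f: "f \<in> carrier (dual_lattice L)"
  shows dual_modulus_upper: "x \<in> carrier L \<Longrightarrow> \<bar>f x\<bar> \<le> modulus (dual_lattice L) f (modulus L x)"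
    and dual_modulus_least: "\<lbrakk>x \<in> pos_cone L;
      \<And>u. \<lbrakk>u \<in> carrier L; x - u \<in> pos_cone L; x + u \<in> pos_cone L\<rbrakk> \<Longrightarrow> f u \<le> c\<rbrakk> \<Longrightarrow>
      modulus (dual_lattice L) f x \<le> c"
proof -
  obtain g where g: "g \<in> carrier (dual_lattice L)"
    "le (dual_lattice L) f g" "le (dual_lattice L) (- f) g"
    "\<And>h. \<lbrakk>h \<in> carrier (dual_lattice L); le (dual_lattice L) f h; le (dual_lattice L) (- f) h\<rbrakk>
      \<Longrightarrow> le (dual_lattice L) g h"
    "\<And>x c. \<lbrakk>x \<in> pos_cone L;
      \<And>u. \<lbrakk>u \<in> carrier L; x - u \<in> pos_cone L; x + u \<in> pos_cone L\<rbrakk> \<Longrightarrow> f u \<le> c\<rbrakk> \<Longrightarrow> g x \<le> c"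
    using dual_modulus_exists[OF f] by metis
  have m: "modulus (dual_lattice L) f = g"
    using f g subspace_neg[OF subspace_dual f]
    by (intro modulus_eqI) (auto intro: dual_antisym)
  show "modulus (dual_lattice L) f x \<le> c"
    if "x \<in> pos_cone L" "\<And>u. \<lbrakk>u \<in> carrier L; x - u \<in> pos_cone L; x + u \<in> pos_cone L\<rbrakk> \<Longrightarrow> f u \<le> c"
    using m g(5) that by simp
  show "\<bar>f x\<bar> \<le> modulus (dual_lattice L) f (modulus L x)" if x: "x \<in> carrier L"
  proof -
    obtain a b where ab: "a \<in> pos_cone L" "b \<in> pos_cone L" "x = a - b" "modulus L x = a + b"
      using pos_decomposition[OF x] by metis
    moreover have "\<bar>f a\<bar> \<le> g a" "\<bar>f b\<bar> \<le> g b"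
      using g(2,3) ab by (auto simp: dual_le_iff abs_le_iff)
    moreover have "f x = f a - f b" "g (modulus L x) = g a + g b"
      using ab dual_diff[OF f, of a b] dual_add[OF g(1), of a b] by (auto simp: carrier_closed pos_in_carrier)
    ultimately show ?thesis
      unfolding m by linarith
  qed
qed

text \<open>The axiom with content is monotonicity of the norm: |f x| <= |f|(|x|) <= |g|(|x|), and
  the last number is a supremum of values g u with |u| <= |x|, each at most the norm of g if x is in
  the unit ball. Applied twice, the lemma covers the bidual.\<close>

lemma dual_normed_riesz: "normed_riesz_space (dual_lattice L)"
proof
  let ?D = "dual_lattice L"
  show "subspace (carrier ?D)"
    by (rule subspace_dual)
  fix f assume f: "f \<in> carrier ?D"
  show "le ?D f f"
    by (simp add: dual_le_iff)
  show "\<exists>s\<in>carrier ?D. le ?D f s \<and> le ?D (- f) s \<and>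
      (\<forall>u\<in>carrier ?D. le ?D f u \<longrightarrow> le ?D (- f) u \<longrightarrow> le ?D s u)"
    using dual_modulus_exists[OF f] by metis
  show "0 \<le> c \<Longrightarrow> le ?D 0 f \<Longrightarrow> le ?D 0 (c *\<^sub>R f)" for c
    by (auto simp: dual_le_iff scaleR_fun_def)
  show "lnorm ?D f = 0 \<longleftrightarrow> f = 0"
  proof
    assume n: "lnorm ?D f = 0"
    have "f x = 0" for x
      using dual_norm_bound[OF f, of x] dual_outside[OF f, of x] n by (cases "x \<in> carrier L") auto
    then show "f = 0"
      by (simp add: fun_eq_iff)
  next
    assume "f = 0"
    then show "lnorm ?D f = 0"
      using dual_norm_le[of 0 f] dual_norm_nonneg[OF f] by auto
  qed
  show hom_le: "lnorm ?D (c *\<^sub>R f) = \<bar>c\<bar> * lnorm ?D f" for c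
  proof -
    \<comment> \<open>Homogeneity needs this inequality for all factors: the opposite one comes from
      the factor 1/c.\<close>
    have le: "lnorm ?D (d *\<^sub>R g) \<le> \<bar>d\<bar> * lnorm ?D g" if g: "g \<in> carrier ?D" for d g
      using dual_norm_upper[OF g] dual_norm_nonneg[OF g]
      by (intro dual_norm_le) (auto simp: scaleR_fun_def abs_mult mult_left_mono)
    show ?thesis
    proof (cases "c = 0")
      case True
      then show ?thesis
        using le[OF f, of c] dual_norm_nonneg[OF subspace_scale[OF subspace_dual f], of c] by simp
    next
      case False
      have "lnorm ?D f \<le> \<bar>1 / c\<bar> * lnorm ?D (c *\<^sub>R f)"
        using le[OF subspace_scale[OF subspace_dual f], of "1 / c" c] False by simp
      then show ?thesis
        using le[OF f, of c] False by (intro antisym) (auto simp: field_simps)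
    qed
  qed
  fix g assume g: "g \<in> carrier ?D"
  show "le ?D f g \<Longrightarrow> le ?D g f \<Longrightarrow> f = g"
    using f g by (rule dual_antisym)
  show "le ?D f g \<Longrightarrow> le ?D g h \<Longrightarrow> le ?D f h" for h
    by (force simp: dual_le_iff)
  show "le ?D f g \<Longrightarrow> le ?D (f + h) (g + h)" for h
    by (force simp: dual_le_iff)
  show "lnorm ?D (f + g) \<le> lnorm ?D f + lnorm ?D g"
  proof (rule dual_norm_le)
    show "0 \<le> lnorm ?D f + lnorm ?D g"
      using dual_norm_nonneg f g by simp
    show "\<bar>(f + g) x\<bar> \<le> lnorm ?D f + lnorm ?D g" if "x \<in> carrier L" "lnorm L x \<le> 1" for x
      using dual_norm_upper[OF f that] dual_norm_upper[OF g that] by simp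
  qed
  assume le: "le ?D (modulus ?D f) (modulus ?D g)"
  show "lnorm ?D f \<le> lnorm ?D g"
  proof (rule dual_norm_le)
    show "0 \<le> lnorm ?D g"
      using dual_norm_nonneg g by simp
    fix x assume x: "x \<in> carrier L" "lnorm L x \<le> 1"
    have "\<bar>f x\<bar> \<le> modulus ?D f (modulus L x)"
      using f x(1) by (rule dual_modulus_upper)
    also have "\<dots> \<le> modulus ?D g (modulus L x)"
      using le modulus_pos[OF x(1)] by (simp add: dual_le_iff)
    also have "\<dots> \<le> lnorm ?D g"
    proof (rule dual_modulus_least[OF g modulus_pos[OF x(1)]])
      fix u assume u: "u \<in> carrier L" "modulus L x - u \<in> pos_cone L" "modulus L x + u \<in> pos_cone L"
      have "lnorm L u \<le> lnorm L (modulus L x)"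
        using u x by (intro lnorm_dominated) (auto simp: modulus_in_carrier)
      then show "g u \<le> lnorm ?D g"
        using dual_norm_upper[OF g u(1)] x by (simp add: lnorm_modulus)
    qed
    finally show "\<bar>f x\<bar> \<le> lnorm ?D g" .
  qed
qed

end

section \<open>Sums of sequences of normed Riesz spaces\<close>

definition single :: "nat \<Rightarrow> 'f::zero \<Rightarrow> nat \<Rightarrow> 'f" where
  "single n x = (\<lambda>k. if k = n then x else 0)"

definition trunc :: "nat \<Rightarrow> (nat \<Rightarrow> 'f::zero) \<Rightarrow> nat \<Rightarrow> 'f" where
  "trunc N g = (\<lambda>n. if n < N then g n else 0)"

lemma sum_fun_eval: "(\<Sum>k\<in>S. g k) n = (\<Sum>k\<in>S. g k n)" for g :: "'k \<Rightarrow> 'n \<Rightarrow> 'f::comm_monoid_add"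
  by (induction S rule: infinite_finite_induct) auto

lemma scaleR_fun_apply: "(c *\<^sub>R f) x = c *\<^sub>R f x"
  by (simp add: scaleR_fun_def)

text \<open>
  Common properties of the \<open>c\<^sub>0\<close>- and \<open>\<ell>\<^sub>p\<close>-sums. The growth bound for disjoint sequences, with an
  exponent below \<open>1\<close>, is what excludes \<open>p = 1\<close>.
\<close>

locale riesz_sequence_sum = homogeneous_norm G
  for G :: "(nat \<Rightarrow> 'f::real_vector) normed_order" +
  fixes F :: "nat \<Rightarrow> 'f normed_order" and \<theta> :: real
  assumes riesz: "normed_riesz_space (F n)"
    and coordinate_closed: "g \<in> carrier G \<Longrightarrow> g n \<in> carrier (F n)"
    and le_coordinatewise: "le G g h \<longleftrightarrow> (\<forall>n. le (F n) (g n) (h n))"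
    and add_closed: "\<lbrakk>g \<in> carrier G; h \<in> carrier G\<rbrakk> \<Longrightarrow> g + h \<in> carrier G"
    and single_closed: "x \<in> carrier (F n) \<Longrightarrow> single n x \<in> carrier G"
    and lnorm_single: "x \<in> carrier (F n) \<Longrightarrow> lnorm G (single n x) = lnorm (F n) x"
    and dominated_closed:
      "\<lbrakk>g \<in> carrier G; \<And>n. h n \<in> carrier (F n); \<And>n. lnorm (F n) (h n) \<le> lnorm (F n) (g n)\<rbrakk>
       \<Longrightarrow> h \<in> carrier G"
    and lnorm_dominated:
      "\<lbrakk>g \<in> carrier G; h \<in> carrier G; \<And>n. lnorm (F n) (h n) \<le> lnorm (F n) (g n)\<rbrakk>
       \<Longrightarrow> lnorm G h \<le> lnorm G g"
    and tail_tendsto: "g \<in> carrier G \<Longrightarrow> (\<lambda>N. lnorm G (g - trunc N g)) \<longlonglongrightarrow> 0"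
    and exponent_less_1: "\<theta> < 1"
    and disjoint_growth:
      "\<lbrakk>\<And>k::nat. e k \<in> carrier G; \<And>k. lnorm G (e k) \<le> 1; \<And>k l n. k \<noteq> l \<Longrightarrow> e k n = 0 \<or> e l n = 0;
        0 < K\<rbrakk>
       \<Longrightarrow> lnorm G (\<Sum>k<K. e k) \<le> real K powr \<theta>"
begin

interpretation riesz: normed_riesz_space "F n" for n
  by (rule riesz)

section \<open>Coordinatewise moduli, truncations and tails\<close>

lemma modulus_closed: "g \<in> carrier G \<Longrightarrow> (\<lambda>n. modulus (F n) (g n)) \<in> carrier G"
  by (rule dominated_closed) (auto simp: riesz.modulus_in_carrier riesz.lnorm_modulus coordinate_closed)

lemma modulus_coordinatewise:
  assumes g: "g \<in> carrier G"
  shows "modulus G g = (\<lambda>n. modulus (F n) (g n))"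
proof (rule modulus_eqI)
  show "- g \<in> carrier G"
    using scaleR_closed[OF g, of "- 1"] by simp
  then have c: "g n \<in> carrier (F n)" "- g n \<in> carrier (F n)" for n
    using g coordinate_closed by fastforce+
  note m = riesz.modulus_props[OF c(1)]
  show "le G g (\<lambda>n. modulus (F n) (g n))" "le G (- g) (\<lambda>n. modulus (F n) (g n))"
    using m c by (auto simp: le_coordinatewise riesz.le_iff_pos)
  show "le G (\<lambda>n. modulus (F n) (g n)) u" if "u \<in> carrier G" "le G g u" "le G (- g) u" for u
    using that m(1,4) c coordinate_closed[OF that(1)] by (auto simp: le_coordinatewise riesz.le_iff_pos)
  show "u = v" if "u \<in> carrier G" "v \<in> carrier G" "le G u v" "le G v u" for u v
    using that by (auto simp: le_coordinatewise coordinate_closed intro!: ext riesz.le_antisym)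
qed (use g modulus_closed in auto)

lemma lnorm_modulus: "g \<in> carrier G \<Longrightarrow> lnorm G (modulus G g) = lnorm G g"
  by (simp add: modulus_coordinatewise)
    (intro antisym lnorm_dominated; simp add: modulus_closed riesz.lnorm_modulus coordinate_closed)

lemma lnorm_pos_mono:
  assumes "g \<in> pos_cone G" "h \<in> carrier G" "le G g h"
  shows "lnorm G g \<le> lnorm G h"
  using assms
  by (intro lnorm_dominated riesz.lnorm_pos_mono)
    (auto simp: pos_cone_def le_coordinatewise coordinate_closed)

lemma trunc_closed: "g \<in> carrier G \<Longrightarrow> trunc N g \<in> carrier G"
  and lnorm_trunc: "g \<in> carrier G \<Longrightarrow> lnorm G (trunc N g) \<le> lnorm G g"
  and tail_closed: "g \<in> carrier G \<Longrightarrow> g - trunc N g \<in> carrier G"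
  and lnorm_tail: "g \<in> carrier G \<Longrightarrow> lnorm G (g - trunc N g) \<le> lnorm G g"
proof -
  assume g: "g \<in> carrier G"
  show 1: "trunc N g \<in> carrier G"
    using g by (rule dominated_closed)
      (auto simp: trunc_def coordinate_closed g riesz.carrier_zero riesz.lnorm_zero riesz.lnorm_nonneg)
  show 2: "g - trunc N g \<in> carrier G"
    using g by (rule dominated_closed)
      (auto simp: trunc_def coordinate_closed g riesz.carrier_zero riesz.lnorm_zero riesz.lnorm_nonneg)
  show "lnorm G (trunc N g) \<le> lnorm G g"
    using g 1 by (rule lnorm_dominated)
      (auto simp: trunc_def coordinate_closed g riesz.lnorm_zero riesz.lnorm_nonneg)
  show "lnorm G (g - trunc N g) \<le> lnorm G g"
    using g 2 by (rule lnorm_dominated)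
      (auto simp: trunc_def coordinate_closed g riesz.lnorm_zero riesz.lnorm_nonneg)
qed

lemma dual_split:
  assumes "y \<in> carrier (dual_lattice G)" "g \<in> carrier G"
  shows "y g = y (trunc N g) + y (g - trunc N g)"
  using dual_add[OF assms(1) trunc_closed[OF assms(2)] tail_closed[OF assms(2)], of N N] by simp

lemma dual_trunc_tendsto:
  assumes y: "y \<in> carrier (dual_lattice G)" and g: "g \<in> carrier G"
  shows "(\<lambda>N. y (trunc N g)) \<longlonglongrightarrow> y g"
proof -
  have "norm (y (trunc N g) - y g) \<le> norm (lnorm G (g - trunc N g)) * lnorm (dual_lattice G) y" for N
    using dual_norm_bound[OF y tail_closed[OF g], of N] dual_split[OF y g, of N]
      lnorm_ge_0[OF tail_closed[OF g], of N]
    by (simp add: mult.commute)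
  then have "(\<lambda>N. y (trunc N g) - y g) \<longlonglongrightarrow> 0"
    by (intro tendsto_0_le[OF tail_tendsto[OF g]] always_eventually) auto
  then show ?thesis
    by (simp add: LIM_zero_iff)
qed

text \<open>
  If the tails of \<open>y\<close> did not become small, there would be a disjoint sequence \<open>g k\<close> in the unit ball
  with \<open>y (g k) > \<epsilon>\<close>, whence \<open>K * \<epsilon> \<le> y (g 0 + \<dots> + g (K - 1)) \<le> \<parallel>y\<parallel> * K powr \<theta>\<close> for all \<open>K\<close>.
\<close>

lemma dual_tail_small:
  assumes y: "y \<in> carrier (dual_lattice G)" and "0 < \<epsilon>"
  shows "\<exists>N. \<forall>g\<in>carrier G. lnorm G g \<le> 1 \<longrightarrow> (\<forall>n<N. g n = 0) \<longrightarrow> y g \<le> \<epsilon>"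
proof (rule ccontr)
  assume contr: "\<not> ?thesis"
  \<comment> \<open>A finite block beyond N: cutting g off at a late M keeps y above \<epsilon>,
    since \<open>y (trunc M g)\<close> tends to \<open>y g\<close>. The clause N <= M makes the
    iteration below monotone.\<close>
  have "\<exists>M g. g \<in> carrier G \<and> lnorm G g \<le> 1 \<and> (\<forall>n. n < N \<or> M \<le> n \<longrightarrow> g n = 0) \<and> \<epsilon> < y g \<and> N \<le> M" for N
  proof -
    obtain g where g: "g \<in> carrier G" "lnorm G g \<le> 1" "\<And>n. n < N \<Longrightarrow> g n = 0" "\<epsilon> < y g"
      using contr by (meson not_le)
    have "\<forall>\<^sub>F M in sequentially. \<epsilon> < y (trunc M g)"
      using dual_trunc_tendsto[OF y g(1)] g(4) by (rule order_tendstoD)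
    then obtain M0 where M0: "\<And>M. M0 \<le> M \<Longrightarrow> \<epsilon> < y (trunc M g)"
      by (auto simp: eventually_sequentially)
    show ?thesis
      using g M0[of "max M0 N"] trunc_closed[OF g(1)] order_trans[OF lnorm_trunc[OF g(1)] g(2)]
      by (intro exI[of _ "max M0 N"] exI[of _ "trunc (max M0 N) g"]) (auto simp: trunc_def)
  qed
  then obtain M b where b: "\<And>N. b N \<in> carrier G" "\<And>N. lnorm G (b N) \<le> 1"
    "\<And>N n. n < N \<or> M N \<le> n \<Longrightarrow> b N n = 0" "\<And>N. \<epsilon> < y (b N)" "\<And>N. N \<le> M N"
    by metis
  \<comment> \<open>Iterating M from 0 starts each block where the previous one ends:
    \<open>g k\<close> is supported on the indices from \<open>a k\<close> up to, but excluding,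
    \<open>a (Suc k)\<close>.\<close>
  define a where "a k = (M ^^ k) 0" for k
  define g where "g k = b (a k)" for k
  have a_Suc: "a (Suc k) = M (a k)" for k
    by (simp add: a_def)
  have "a k \<le> a (Suc k)" for k
    by (simp add: a_Suc b)
  then have a_mono: "a k \<le> a l" if "k \<le> l" for k l
    using that by (rule lift_Suc_mono_le)
  have disj1: "g k n = 0 \<or> g l n = 0" if "k < l" for k l n
    using b(3)[of n "a k"] b(3)[of n "a l"] a_mono[of "Suc k" l] that
    by (cases "n < a l") (auto simp: g_def a_Suc)
  have disj: "g k n = 0 \<or> g l n = 0" if "k \<noteq> l" for k l n
    using disj1[of k l n] disj1[of l k n] that by linarith
  have gc: "g k \<in> carrier G" "lnorm G (g k) \<le> 1" for k
    by (simp_all add: g_def b)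
  have sumc: "(\<Sum>k<K. g k) \<in> carrier G" for K :: nat
    by (induction K) (simp_all only: sum.lessThan_Suc lessThan_0 sum.empty zero_closed add_closed gc)
  have y_sum: "y (\<Sum>k<K. g k) = (\<Sum>k<K. y (g k))" for K :: nat
  proof (induction K)
    case 0
    then show ?case
      using dual_zero[OF y zero_closed] by (simp only: lessThan_0 sum.empty)
  next
    case (Suc K)
    then show ?case
      using dual_add[OF y sumc gc(1), of K K] by (simp only: sum.lessThan_Suc)
  qed
  let ?C = "lnorm (dual_lattice G) y"
  have growth: "real K * \<epsilon> \<le> ?C * real K powr \<theta>" if "0 < K" for K
  proof -
    have "real K * \<epsilon> = (\<Sum>k<K. \<epsilon>)"
      by simp
    also have "\<dots> \<le> (\<Sum>k<K. y (g k))"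
      using b(4) by (intro sum_mono) (simp add: g_def less_imp_le)
    also have "\<dots> \<le> ?C * lnorm G (\<Sum>k<K. g k)"
      using dual_norm_bound[OF y sumc, of K] by (simp add: y_sum)
    also have "\<dots> \<le> ?C * real K powr \<theta>"
      using disjoint_growth[OF gc disj that] dual_norm_nonneg[OF y] by (intro mult_left_mono) auto
    finally show ?thesis .
  qed
  \<comment> \<open>The threshold solves \<open>b powr (1 - \<theta>) = ?C / \<epsilon> + 1\<close>,
    so every K > b contradicts \<open>growth\<close>. The summand 1 keeps the base positive even if
    \<open>?C\<close> is 0.\<close>
  define b where "b = (?C / \<epsilon> + 1) powr (1 / (1 - \<theta>))"
  have pos: "0 < ?C / \<epsilon> + 1"
    using dual_norm_nonneg[OF y] \<open>0 < \<epsilon>\<close> by (simp add: add_nonneg_pos)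
  obtain K :: nat where "b < real K"
    using reals_Archimedean2 by blast
  moreover have "0 < b"
    using pos by (simp add: b_def)
  ultimately have "0 < K" "b powr (1 - \<theta>) < real K powr (1 - \<theta>)"
    using exponent_less_1 by (auto intro: powr_less_mono2 simp del: of_nat_0_less_iff simp flip: of_nat_0_less_iff)
  moreover have "b powr (1 - \<theta>) = ?C / \<epsilon> + 1"
    using pos exponent_less_1 by (simp add: b_def powr_powr)
  ultimately have K: "?C / \<epsilon> < real K powr (1 - \<theta>)" "0 < K"
    by auto
  have "?C * real K powr \<theta> < \<epsilon> * real K powr (1 - \<theta>) * real K powr \<theta>"
    using K \<open>0 < \<epsilon>\<close> by (intro mult_strict_right_mono) (auto simp: field_simps)
  also have "\<dots> = real K * \<epsilon>"
    using K by (simp flip: powr_add)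
  finally show False
    using growth[OF K(2)] by simp
qed

text \<open>The adjoint of the n-th coordinate projection. Below, \<open>restr n\<close> is the
  adjoint of the embedding \<open>single n\<close>, and \<open>coord n\<close> is the second adjoint
  of the projection. All are 0 outside the carrier, as members of a dual have to be.\<close>

definition pull :: "nat \<Rightarrow> ('f \<Rightarrow> real) \<Rightarrow> (nat \<Rightarrow> 'f) \<Rightarrow> real" where
  "pull n \<phi> = (\<lambda>g. if g \<in> carrier G then \<phi> (g n) else 0)"

definition restr :: "nat \<Rightarrow> ((nat \<Rightarrow> 'f) \<Rightarrow> real) \<Rightarrow> 'f \<Rightarrow> real" where
  "restr n y = (\<lambda>x. if x \<in> carrier (F n) then y (single n x) else 0)"

definition coord :: "nat \<Rightarrow> (((nat \<Rightarrow> 'f) \<Rightarrow> real) \<Rightarrow> real) \<Rightarrow> ('f \<Rightarrow> real) \<Rightarrow> real" where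
  "coord n w = (\<lambda>\<phi>. if \<phi> \<in> carrier (dual_lattice (F n)) then w (pull n \<phi>) else 0)"

text \<open>Domination of \<open>single n (g n)\<close> by g makes the projections contractive, and
  with them their adjoints \<open>pull n\<close>.\<close>

lemma lnorm_coordinate:
  assumes "g \<in> carrier G"
  shows "lnorm (F n) (g n) \<le> lnorm G g"
proof -
  have c: "g n \<in> carrier (F n)"
    using assms by (rule coordinate_closed)
  have "lnorm G (single n (g n)) \<le> lnorm G g"
    using assms single_closed[OF c]
    by (rule lnorm_dominated) (auto simp: single_def riesz.lnorm_zero riesz.lnorm_nonneg coordinate_closed assms)
  then show ?thesis
    using c by (simp add: lnorm_single)
qed

lemma pull_bound:
  assumes "\<phi> \<in> carrier (dual_lattice (F n))" "g \<in> carrier G"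
  shows "\<bar>\<phi> (g n)\<bar> \<le> lnorm (dual_lattice (F n)) \<phi> * lnorm G g"
  using riesz.dual_norm_bound[OF assms(1) coordinate_closed[OF assms(2)]]
    mult_left_mono[OF lnorm_coordinate[OF assms(2), of n] riesz.dual_norm_nonneg[OF assms(1)]]
  by simp

lemma pull_closed:
  assumes \<phi>: "\<phi> \<in> carrier (dual_lattice (F n))"
  shows "pull n \<phi> \<in> carrier (dual_lattice G)"
  unfolding dual_iff
proof (intro conjI)
  show "\<exists>K. \<forall>g\<in>carrier G. \<bar>pull n \<phi> g\<bar> \<le> K * lnorm G g"
    using pull_bound[OF \<phi>] by (auto simp: pull_def)
qed (auto simp: pull_def add_closed scaleR_closed dual_add[OF \<phi>] dual_scaleR[OF \<phi>] coordinate_closed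
      scaleR_fun_apply)

lemma pull_add: "pull n (\<phi> + \<psi>) = pull n \<phi> + pull n \<psi>"
  and pull_scaleR: "pull n (c *\<^sub>R \<phi>) = c *\<^sub>R pull n \<phi>"
  by (auto simp: pull_def scaleR_fun_def)

lemma single_add: "single n (x + y) = single n x + single n (y :: 'f)"
  and single_scaleR: "single n (c *\<^sub>R x) = c *\<^sub>R single n (x :: 'f)"
  by (auto simp: single_def scaleR_fun_def)

lemma restr_closed:
  assumes y: "y \<in> carrier (dual_lattice G)"
  shows "restr n y \<in> carrier (dual_lattice (F n))"
  unfolding dual_iff
proof (intro conjI)
  have "\<bar>restr n y x\<bar> \<le> lnorm (dual_lattice G) y * lnorm (F n) x" if "x \<in> carrier (F n)" for x
    using dual_norm_bound[OF y single_closed[OF that]] that by (simp add: restr_def lnorm_single)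
  then show "\<exists>K. \<forall>x\<in>carrier (F n). \<bar>restr n y x\<bar> \<le> K * lnorm (F n) x"
    by blast
qed (auto simp: restr_def riesz.carrier_closed single_add single_scaleR dual_add[OF y] dual_scaleR[OF y]
      single_closed)

lemma lnorm_pull:
  assumes "\<phi> \<in> carrier (dual_lattice (F n))"
  shows "lnorm (dual_lattice G) (pull n \<phi>) \<le> lnorm (dual_lattice (F n)) \<phi>"
proof (rule dual_norm_le)
  show "0 \<le> lnorm (dual_lattice (F n)) \<phi>"
    using assms by (rule riesz.dual_norm_nonneg)
  show "\<bar>pull n \<phi> g\<bar> \<le> lnorm (dual_lattice (F n)) \<phi>" if "g \<in> carrier G" "lnorm G g \<le> 1" for g
    using pull_bound[OF assms that(1)] riesz.dual_norm_nonneg[OF assms] that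
      mult_left_mono[of "lnorm G g" 1 "lnorm (dual_lattice (F n)) \<phi>"]
    by (simp add: pull_def)
qed

lemma coord_closed:
  assumes w: "w \<in> carrier (bidual G)"
  shows "coord n w \<in> carrier (bidual (F n))"
proof -
  obtain K where K: "\<And>y. y \<in> carrier (dual_lattice G) \<Longrightarrow> \<bar>w y\<bar> \<le> K * lnorm (dual_lattice G) y"
    using w unfolding dual_iff[of w] by blast
  have "\<bar>w (pull n \<phi>)\<bar> \<le> \<bar>K\<bar> * lnorm (dual_lattice (F n)) \<phi>"
    if "\<phi> \<in> carrier (dual_lattice (F n))" for \<phi>
  proof -
    have "\<bar>w (pull n \<phi>)\<bar> \<le> K * lnorm (dual_lattice G) (pull n \<phi>)"
      using K pull_closed[OF that] by blast
    also have "\<dots> \<le> \<bar>K\<bar> * lnorm (dual_lattice (F n)) \<phi>"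
      using lnorm_pull[OF that] dual_norm_nonneg[OF pull_closed[OF that]] by (intro mult_mono) auto
    finally show ?thesis .
  qed
  then have ex: "\<exists>K. \<forall>\<phi>\<in>carrier (dual_lattice (F n)). \<bar>coord n w \<phi>\<bar> \<le> K * lnorm (dual_lattice (F n)) \<phi>"
    by (auto simp: coord_def)
  show ?thesis
    unfolding dual_iff[of "coord n w"]
  proof (intro conjI)
    show "\<forall>\<phi>\<in>carrier (dual_lattice (F n)). \<forall>\<psi>\<in>carrier (dual_lattice (F n)).
        coord n w (\<phi> + \<psi>) = coord n w \<phi> + coord n w \<psi>"
      by (auto simp: coord_def subspace_add[OF subspace_dual] pull_add dual_add[OF w] pull_closed)
    show "\<forall>c. \<forall>\<phi>\<in>carrier (dual_lattice (F n)). coord n w (c *\<^sub>R \<phi>) = c * coord n w \<phi>"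
      by (auto simp: coord_def subspace_scale[OF subspace_dual] pull_scaleR dual_scaleR[OF w] pull_closed)
  qed (use ex in \<open>auto simp: coord_def\<close>)
qed

lemma coord_minus:
  "coord n (- w) = - coord n w"
  by (auto simp: coord_def)

text \<open>Since \<open>trunc (Suc N) g\<close> adds \<open>single N (g N)\<close>, the partial
  sums of y are y composed with truncation, and y minus such a sum sees only tails.\<close>

lemma sum_pull_restr:
  assumes y: "y \<in> carrier (dual_lattice G)" and g: "g \<in> carrier G"
  shows "(\<Sum>n<N. pull n (restr n y)) g = y (trunc N g)"
proof (induction N)
  case 0
  have "trunc 0 g = 0"
    by (rule ext) (simp add: trunc_def)
  then have "y (trunc 0 g) = 0"
    using dual_zero[OF y zero_closed] by (simp only:)
  then show ?case
    by simp
next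
  case (Suc N)
  have "trunc (Suc N) g = trunc N g + single N (g N)"
    by (auto simp: trunc_def single_def less_Suc_eq)
  then have "y (trunc (Suc N) g) = y (trunc N g) + y (single N (g N))"
    using dual_add[OF y trunc_closed[OF g] single_closed[OF coordinate_closed[OF g]]]
    by (simp only:)
  moreover have "pull N (restr N y) g = y (single N (g N))"
    using g by (simp add: pull_def restr_def coordinate_closed)
  ultimately show ?case
    using Suc by simp
qed

text \<open>The bound of \<open>dual_tail_small\<close> is uniform on the unit ball, and tails of
  elements of the ball stay in the ball; so the convergence is in norm.\<close>

lemma dual_approx:
  assumes y: "y \<in> carrier (dual_lattice G)"
  shows "(\<lambda>N. lnorm (dual_lattice G) (y - (\<Sum>n<N. pull n (restr n y)))) \<longlonglongrightarrow> 0"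
proof (rule LIMSEQ_I)
  let ?T = "\<lambda>N. \<Sum>n<N. pull n (restr n y)"
  have T: "?T N \<in> carrier (dual_lattice G)" for N
    by (intro subspace_sum subspace_dual pull_closed restr_closed y)
  fix r :: real assume "0 < r"
  then have r: "0 < r / 2" by simp
  obtain N where N: "\<And>g. \<lbrakk>g \<in> carrier G; lnorm G g \<le> 1; \<And>n. n < N \<Longrightarrow> g n = 0\<rbrakk> \<Longrightarrow> y g \<le> r / 2"
    using dual_tail_small[OF y r] by metis
  have "lnorm (dual_lattice G) (y - ?T M) \<le> r / 2" if "N \<le> M" for M
  proof (rule dual_norm_le)
    fix g assume g: "g \<in> carrier G" "lnorm G g \<le> 1"
    let ?t = "g - trunc M g"
    have t: "?t \<in> carrier G" "lnorm G ?t \<le> 1"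
      using tail_closed[OF g(1)] order_trans[OF lnorm_tail[OF g(1)] g(2)] by auto
    have "y ?t \<le> r / 2"
      using t that by (intro N) (auto simp: trunc_def)
    \<comment> \<open>\<open>dual_tail_small\<close> bounds y from above only; the negated tail
      supplies the absolute value.\<close>
    moreover have "y (- ?t) \<le> r / 2"
      using t that scaleR_closed[OF t(1), of "- 1"] lnorm_homogeneous[OF t(1), of "- 1"]
      by (intro N) (auto simp: trunc_def)
    ultimately show "\<bar>(y - ?T M) g\<bar> \<le> r / 2"
      using dual_split[OF y g(1), of M] dual_minus[OF y t(1)]
      by (simp add: sum_pull_restr[OF y g(1)])
  qed (use r in simp)
  then have "norm (lnorm (dual_lattice G) (y - ?T M) - 0) < r" if "N \<le> M" for M
    using that r dual_norm_nonneg[OF subspace_diff[OF subspace_dual y T], of M] by fastforce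
  then show "\<exists>N. \<forall>M\<ge>N. norm (lnorm (dual_lattice G) (y - ?T M) - 0) < r"
    by blast
qed

text \<open>Continuity of w is applied to the norm convergence of the partial sums of y. Through
  this formula the functionals \<open>coord n w\<close> decide order and equality in the bidual of
  G.\<close>

lemma bidual_coord_sums:
  assumes w: "w \<in> carrier (bidual G)" and y: "y \<in> carrier (dual_lattice G)"
  shows "(\<lambda>n. coord n w (restr n y)) sums w y"
  unfolding sums_def
proof -
  let ?T = "\<lambda>N. \<Sum>n<N. pull n (restr n y)"
  have T: "?T N \<in> carrier (dual_lattice G)" for N
    by (intro subspace_sum subspace_dual pull_closed restr_closed y)
  have wT: "w (?T N) = (\<Sum>n<N. coord n w (restr n y))" for N
  proof (induction N)
    case 0
    then show ?case
      using dual_zero[OF w subspace_0[OF subspace_dual]] by (simp only: lessThan_0 sum.empty)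
  next
    case (Suc N)
    then show ?case
      using dual_add[OF w T pull_closed[OF restr_closed[OF y]], of N N]
      by (simp only: sum.lessThan_Suc coord_def restr_closed[OF y] if_True)
  qed
  obtain K where K: "\<And>y. y \<in> carrier (dual_lattice G) \<Longrightarrow> \<bar>w y\<bar> \<le> K * lnorm (dual_lattice G) y"
    using w unfolding dual_iff[of w] by blast
  have "norm (w (?T N) - w y) \<le> norm (lnorm (dual_lattice G) (y - ?T N)) * K" for N
  proof -
    have "w (y - ?T N) = w y - w (?T N)"
      using dual_diff[OF w y T subspace_neg[OF subspace_dual T]] .
    then show ?thesis
      using K[OF subspace_diff[OF subspace_dual y T], of N]
        dual_norm_nonneg[OF subspace_diff[OF subspace_dual y T], of N]
      by (simp add: mult.commute)
  qed
  then have "(\<lambda>N. w (?T N) - w y) \<longlonglongrightarrow> 0"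
    by (intro tendsto_0_le[OF dual_approx[OF y]] always_eventually) auto
  then show "(\<lambda>N. \<Sum>n<N. coord n w (restr n y)) \<longlonglongrightarrow> w y"
    by (simp add: LIM_zero_iff wT)
qed

lemma pull_pos:
  "\<phi> \<in> pos_cone (dual_lattice (F n)) \<Longrightarrow> pull n \<phi> \<in> pos_cone (dual_lattice G)"
  by (auto simp: pos_cone_def pull_closed)
    (auto simp: dual_le_iff pull_def pos_cone_def le_coordinatewise coordinate_closed)

lemma restr_pos:
  assumes "y \<in> pos_cone (dual_lattice G)"
  shows "restr n y \<in> pos_cone (dual_lattice (F n))"
proof -
  have "0 \<le> y (single n x)" if "x \<in> pos_cone (F n)" for x
  proof -
    have "single n x \<in> pos_cone G"
      using that riesz.pos_zero
      by (auto simp: pos_cone_def le_coordinatewise single_closed) (auto simp: single_def)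
    then show ?thesis
      using assms by (simp add: pos_cone_def[of "dual_lattice G"] dual_le_iff)
  qed
  then show ?thesis
    using assms by (simp add: pos_cone_def[of "dual_lattice _"] restr_closed)
      (auto simp: dual_le_iff restr_def)
qed

text \<open>One direction tests on the positive functionals \<open>pull n \<phi>\<close>; the other
  compares the series of \<open>bidual_coord_sums\<close> term by term at a positive y.\<close>

lemma bidual_le_iff_coord:
  assumes "v \<in> carrier (bidual G)" "w \<in> carrier (bidual G)"
  shows "le (bidual G) v w \<longleftrightarrow> (\<forall>n. le (bidual (F n)) (coord n v) (coord n w))"
proof
  assume *: "\<forall>n. le (bidual (F n)) (coord n v) (coord n w)"
  have "v y \<le> w y" if y: "y \<in> pos_cone (dual_lattice G)" for y
  proof -
    have yc: "y \<in> carrier (dual_lattice G)"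
      using y by (simp add: pos_cone_def)
    show ?thesis
      using * restr_pos[OF y]
      by (intro sums_le[OF _ bidual_coord_sums[OF assms(1) yc] bidual_coord_sums[OF assms(2) yc]])
        (simp add: dual_le_iff)
  qed
  then show "le (bidual G) v w"
    by (simp add: dual_le_iff)
next
  assume "le (bidual G) v w"
  then have *: "v (pull n \<phi>) \<le> w (pull n \<phi>)" if "\<phi> \<in> pos_cone (dual_lattice (F n))" for n \<phi>
    using pull_pos[OF that] by (auto simp: dual_le_iff[of "dual_lattice G"])
  show "\<forall>n. le (bidual (F n)) (coord n v) (coord n w)"
    by (auto simp: dual_le_iff[of "dual_lattice (F _)"] coord_def *)
qed

lemma bidual_eqI_coord:
  assumes "v \<in> carrier (bidual G)" "w \<in> carrier (bidual G)" "\<And>n. coord n v = coord n w"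
  shows "v = w"
proof
  fix y
  show "v y = w y"
  proof (cases "y \<in> carrier (dual_lattice G)")
    case True
    then show ?thesis
      using bidual_coord_sums[OF assms(1) True] bidual_coord_sums[OF assms(2) True]
      by (simp add: assms(3) sums_unique2)
  qed (use assms in \<open>simp add: dual_outside[of _ "dual_lattice G"]\<close>)
qed

text \<open>A modulus is characterised by order and equality, and both are coordinatewise. That s
  lies in the bidual of G is assumed: in the application s is a value of the extension.\<close>

lemma bidual_modulus_coord:
  assumes w: "w \<in> carrier (bidual G)" and s: "s \<in> carrier (bidual G)"
    and coord: "\<And>n. modulus (bidual (F n)) (coord n w) = coord n s"
  shows "modulus (bidual G) w = s"
proof (rule modulus_eqI)
  interpret b: normed_riesz_space "bidual (F n)" for n
    by (intro normed_riesz_space.dual_normed_riesz riesz)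
  note cc = coord_closed
  note m = b.modulus_props[OF cc[OF w], unfolded coord]
  show mw: "- w \<in> carrier (bidual G)"
    by (rule subspace_neg[OF subspace_dual w])
  show "le (bidual G) w s" "le (bidual G) (- w) s"
    using m w s mw by (auto simp: bidual_le_iff_coord b.le_iff_pos cc b.carrier_minus coord_minus)
  show "le (bidual G) s u" if "u \<in> carrier (bidual G)" "le (bidual G) w u" "le (bidual G) (- w) u" for u
    using that m w s mw by (auto simp: bidual_le_iff_coord b.le_iff_pos cc b.carrier_minus coord_minus)
  show "u = v"
    if "u \<in> carrier (bidual G)" "v \<in> carrier (bidual G)" "le (bidual G) u v" "le (bidual G) v u" for u v
    using that by (intro bidual_eqI_coord b.le_antisym) (auto simp: bidual_le_iff_coord cc)
qed (use w s in auto)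

end

text \<open>At most one summand survives at n. If none does, the index 0, admissible by 0 < K, gives
  the value 0 as well.\<close>

lemma disjoint_sum_eq:
  fixes e :: "nat \<Rightarrow> nat \<Rightarrow> 'f::comm_monoid_add"
  assumes "\<And>k l n. k \<noteq> l \<Longrightarrow> e k n = 0 \<or> e l n = 0" and "0 < K"
  obtains k where "k < K" "(\<Sum>k<K. e k) n = e k n"
proof (cases "\<exists>k<K. e k n \<noteq> 0")
  case True
  then obtain k where k: "k < K" "e k n \<noteq> 0" by blast
  have "(\<Sum>l<K. e l n) = (\<Sum>l\<in>{k}. e l n)"
    using k assms(1) by (intro sum.mono_neutral_right) auto
  then show ?thesis
    using k(1) that by (simp add: sum_fun_eval)
next
  case False
  then show ?thesis
    using assms(2) by (intro that[of 0]) (auto simp: sum_fun_eval)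
qed

context
  fixes F :: "nat \<Rightarrow> 'f::real_vector normed_order"
  assumes F: "\<And>n. normed_riesz_space (F n)"
begin

interpretation riesz: normed_riesz_space "F n" for n
  by (rule F)

section \<open>The c0-sum as an instance, with exponent 0\<close>

lemma c0_sum_iff:
  "g \<in> carrier (c0_sum F) \<longleftrightarrow> (\<forall>n. g n \<in> carrier (F n)) \<and> (\<lambda>n. lnorm (F n) (g n)) \<longlonglongrightarrow> 0"
  by (simp add: c0_sum_def)

lemma c0_norm_upper:
  assumes "g \<in> carrier (c0_sum F)"
  shows "lnorm (F n) (g n) \<le> lnorm (c0_sum F) g"
proof -
  have "Bseq (\<lambda>n. lnorm (F n) (g n))"
    using assms by (auto simp: c0_sum_iff intro: convergent_imp_Bseq convergentI)
  then obtain K where "\<And>n. norm (lnorm (F n) (g n)) \<le> K"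
    unfolding Bseq_def by blast
  then have "bdd_above (range (\<lambda>n. lnorm (F n) (g n)))"
    by (intro bdd_aboveI2[where M = K]) (auto simp: abs_le_iff)
  then show ?thesis
    by (auto simp: c0_sum_def intro: cSUP_upper)
qed

lemma c0_norm_le:
  assumes "\<And>n. lnorm (F n) (g n) \<le> K"
  shows "lnorm (c0_sum F) g \<le> K"
  using assms by (auto simp: c0_sum_def intro: cSUP_least)

lemma c0_dominated_closed:
  assumes "g \<in> carrier (c0_sum F)" "\<And>n. h n \<in> carrier (F n)"
    "\<And>n. lnorm (F n) (h n) \<le> lnorm (F n) (g n)"
  shows "h \<in> carrier (c0_sum F)"
  using assms tendsto_sandwich[of "\<lambda>_. 0" "\<lambda>n. lnorm (F n) (h n)" sequentially "\<lambda>n. lnorm (F n) (g n)" 0]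
  by (auto simp: c0_sum_iff riesz.lnorm_nonneg)

lemma c0_scaleR_closed:
  assumes "g \<in> carrier (c0_sum F)"
  shows "c *\<^sub>R g \<in> carrier (c0_sum F)"
  using assms tendsto_mult_right_zero[of "\<lambda>n. lnorm (F n) (g n)" sequentially "\<bar>c\<bar>"]
  by (auto simp: c0_sum_iff scaleR_fun_apply riesz.carrier_closed riesz.lnorm_scaleR)

lemma c0_norm_scaleR_le:
  assumes "g \<in> carrier (c0_sum F)"
  shows "lnorm (c0_sum F) (c *\<^sub>R g) \<le> \<bar>c\<bar> * lnorm (c0_sum F) g"
  using assms c0_norm_upper[OF assms]
  by (intro c0_norm_le) (auto simp: scaleR_fun_apply riesz.lnorm_scaleR c0_sum_iff mult_left_mono)

lemma c0_norm_nonneg: "g \<in> carrier (c0_sum F) \<Longrightarrow> 0 \<le> lnorm (c0_sum F) g"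
  using c0_norm_upper[of g 0] riesz.lnorm_nonneg[of "g 0" 0] by (auto simp: c0_sum_iff)

lemma c0_riesz_sequence_sum: "riesz_sequence_sum (c0_sum F) F 0"
proof
  show "0 \<in> carrier (c0_sum F)"
    by (simp add: c0_sum_iff riesz.carrier_zero riesz.lnorm_zero)
  show "le (c0_sum F) g h \<longleftrightarrow> (\<forall>n. le (F n) (g n) (h n))" for g h
    by (simp add: c0_sum_def)
  fix g assume g: "g \<in> carrier (c0_sum F)"
  show "c *\<^sub>R g \<in> carrier (c0_sum F)" for c
    using g by (rule c0_scaleR_closed)
  show "lnorm (c0_sum F) (c *\<^sub>R g) = \<bar>c\<bar> * lnorm (c0_sum F) g" for c
  proof (cases "c = 0")
    case True
    then show ?thesis
      using c0_norm_scaleR_le[OF g, of c] c0_norm_nonneg[OF c0_scaleR_closed[OF g, of c]] by simp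
  next
    case False
    have "lnorm (c0_sum F) g \<le> \<bar>1 / c\<bar> * lnorm (c0_sum F) (c *\<^sub>R g)"
      using c0_norm_scaleR_le[OF c0_scaleR_closed[OF g, of c], of "1 / c"] False by simp
    then show ?thesis
      using c0_norm_scaleR_le[OF g, of c] False by (intro antisym) (auto simp: field_simps)
  qed
  show "0 \<le> lnorm (c0_sum F) g"
    using g by (rule c0_norm_nonneg)
  show gn: "g n \<in> carrier (F n)" for n
    using g by (simp add: c0_sum_iff)
  show "h \<in> carrier (c0_sum F)"
    if "\<And>n. h n \<in> carrier (F n)" "\<And>n. lnorm (F n) (h n) \<le> lnorm (F n) (g n)" for h
    using g that by (rule c0_dominated_closed)
  show "lnorm (c0_sum F) h \<le> lnorm (c0_sum F) g"
    if "\<And>n. lnorm (F n) (h n) \<le> lnorm (F n) (g n)" for h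
    using order_trans[OF that c0_norm_upper[OF g]] by (rule c0_norm_le)
  have lim: "(\<lambda>n. lnorm (F n) (g n)) \<longlonglongrightarrow> 0"
    using g by (simp add: c0_sum_iff)
  show "g + h \<in> carrier (c0_sum F)" if h: "h \<in> carrier (c0_sum F)" for h
  proof -
    have "(\<lambda>n. lnorm (F n) (g n) + lnorm (F n) (h n)) \<longlonglongrightarrow> 0 + 0"
      using lim h by (intro tendsto_add) (auto simp: c0_sum_iff)
    then have sum_lim: "(\<lambda>n. lnorm (F n) (g n) + lnorm (F n) (h n)) \<longlonglongrightarrow> 0"
      by simp
    have hn: "h n \<in> carrier (F n)" for n
      using h by (simp add: c0_sum_iff)
    have "(\<lambda>n. lnorm (F n) (g n + h n)) \<longlonglongrightarrow> 0"
      using riesz.lnorm_nonneg[OF riesz.carrier_add[OF gn hn]] riesz.lnorm_triangle[OF gn hn]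
      by (intro tendsto_sandwich[OF _ _ tendsto_const sum_lim] always_eventually allI)
    then show ?thesis
      using gn h by (auto simp: c0_sum_iff riesz.carrier_closed)
  qed
  show "(\<lambda>N. lnorm (c0_sum F) (g - trunc N g)) \<longlonglongrightarrow> 0"
  proof (rule LIMSEQ_I)
    fix r :: real assume r: "0 < r"
    \<comment> \<open>A supremum of numbers below r/2 is at most r/2, hence strictly below
      r.\<close>
    obtain N where N: "\<And>n. N \<le> n \<Longrightarrow> lnorm (F n) (g n) < r / 2"
      using order_tendstoD(2)[OF lim, of "r / 2"] r by (auto simp: eventually_sequentially)
    have "norm (lnorm (c0_sum F) (g - trunc M g) - 0) < r" if "N \<le> M" for M
    proof -
      have "lnorm (c0_sum F) (g - trunc M g) \<le> r / 2"
        using N that r by (intro c0_norm_le) (auto simp: trunc_def riesz.lnorm_zero less_imp_le)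
      moreover have "g - trunc M g \<in> carrier (c0_sum F)"
        using g by (rule c0_dominated_closed)
          (auto simp: trunc_def gn riesz.carrier_zero riesz.lnorm_zero riesz.lnorm_nonneg)
      ultimately show ?thesis
        using r c0_norm_nonneg[of "g - trunc M g"] by simp
    qed
    then show "\<exists>N. \<forall>M\<ge>N. norm (lnorm (c0_sum F) (g - trunc M g) - 0) < r"
      by blast
  qed
next
  fix x n assume x: "x \<in> carrier (F n)"
  have "(\<lambda>k. lnorm (F k) (single n x k)) = single n (lnorm (F n) x)"
    by (auto simp: single_def riesz.lnorm_zero)
  moreover have "single n (lnorm (F n) x) \<longlonglongrightarrow> 0"
    by (intro tendsto_eventually eventually_sequentiallyI[of "Suc n"]) (simp add: single_def)
  ultimately show s: "single n x \<in> carrier (c0_sum F)"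
    using x by (auto simp: c0_sum_iff) (auto simp: single_def riesz.carrier_zero)
  show "lnorm (c0_sum F) (single n x) = lnorm (F n) x"
    using c0_norm_upper[OF s, of n] x
    by (intro antisym c0_norm_le) (auto simp: single_def riesz.lnorm_zero riesz.lnorm_nonneg)
next
  fix e :: "nat \<Rightarrow> nat \<Rightarrow> 'f" and K :: nat
  assume e: "\<And>k. e k \<in> carrier (c0_sum F)" "\<And>k. lnorm (c0_sum F) (e k) \<le> 1"
    "\<And>k l n. k \<noteq> l \<Longrightarrow> e k n = 0 \<or> e l n = 0" and K: "0 < K"
  have "lnorm (c0_sum F) (\<Sum>k<K. e k) \<le> 1"
  proof (rule c0_norm_le)
    fix n
    obtain k where "(\<Sum>k<K. e k) n = e k n"
      by (rule disjoint_sum_eq[OF e(3) K])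
    then show "lnorm (F n) ((\<Sum>k<K. e k) n) \<le> 1"
      using order_trans[OF c0_norm_upper[OF e(1)] e(2)] by simp
  qed
  then show "lnorm (c0_sum F) (\<Sum>k<K. e k) \<le> real K powr 0"
    using K by simp
qed simp

section \<open>The lp-sum as an instance, with exponent 1/p\<close>

lemma lp_sum_iff:
  "g \<in> carrier (lp_sum p F) \<longleftrightarrow>
    (\<forall>n. g n \<in> carrier (F n)) \<and> summable (\<lambda>n. lnorm (F n) (g n) powr p)"
  by (simp add: lp_sum_def)

lemma lnorm_lp: "lnorm (lp_sum p F) g = (\<Sum>n. lnorm (F n) (g n) powr p) powr (1 / p)"
  by (simp add: lp_sum_def)

lemma lp_dominated_closed:
  assumes "0 < p" "g \<in> carrier (lp_sum p F)" "\<And>n. h n \<in> carrier (F n)"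
    "\<And>n. lnorm (F n) (h n) \<le> lnorm (F n) (g n)"
  shows "h \<in> carrier (lp_sum p F)"
proof -
  have "summable (\<lambda>n. lnorm (F n) (g n) powr p)"
    using assms(2) by (simp add: lp_sum_iff)
  moreover have "norm (lnorm (F n) (h n) powr p) \<le> lnorm (F n) (g n) powr p" for n
    using powr_mono2[OF _ riesz.lnorm_nonneg[OF assms(3)] assms(4)] assms(1) by simp
  ultimately have "summable (\<lambda>n. lnorm (F n) (h n) powr p)"
    by (rule summable_comparison_test')
  then show ?thesis
    using assms(3) by (simp add: lp_sum_iff)
qed

text \<open>Only summability is at stake, so the crude estimate (a + b)^p <= (2 max a b)^p <= 2^p
  (a^p + b^p) does the work.\<close>

lemma lp_add_closed:
  assumes p: "0 < p" and g: "g \<in> carrier (lp_sum p F)" and h: "h \<in> carrier (lp_sum p F)"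
  shows "g + h \<in> carrier (lp_sum p F)"
proof -
  have c: "g n \<in> carrier (F n)" "h n \<in> carrier (F n)" for n
    using g h by (auto simp: lp_sum_iff)
  have "lnorm (F n) (g n + h n) powr p
      \<le> 2 powr p * (lnorm (F n) (g n) powr p + lnorm (F n) (h n) powr p)" for n
  proof -
    define a b where "a = lnorm (F n) (g n)" and "b = lnorm (F n) (h n)"
    have "lnorm (F n) (g n + h n) \<le> 2 * max a b"
      using riesz.lnorm_triangle[OF c(1) c(2)[of n]] unfolding a_def b_def by linarith
    then have "lnorm (F n) (g n + h n) powr p \<le> (2 * max a b) powr p"
      using p c by (intro powr_mono2) (auto simp: riesz.lnorm_nonneg riesz.carrier_closed)
    also have "\<dots> = 2 powr p * max a b powr p"
      by (rule powr_mult)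
    also have "\<dots> \<le> 2 powr p * (a powr p + b powr p)"
      by (intro mult_left_mono) (auto simp: max_def)
    finally show ?thesis
      by (simp add: a_def b_def)
  qed
  then have le: "norm (lnorm (F n) (g n + h n) powr p)
      \<le> 2 powr p * (lnorm (F n) (g n) powr p + lnorm (F n) (h n) powr p)" for n
    by simp
  have "summable (\<lambda>n. 2 powr p * (lnorm (F n) (g n) powr p + lnorm (F n) (h n) powr p))"
    using g h by (intro summable_mult summable_add) (auto simp: lp_sum_iff)
  then have "summable (\<lambda>n. lnorm (F n) (g n + h n) powr p)"
    by (rule summable_comparison_test'[OF _ le])
  then show ?thesis
    using c by (auto simp: lp_sum_iff riesz.carrier_closed)
qed

lemma lp_riesz_sequence_sum:
  assumes p: "1 < p"
  shows "riesz_sequence_sum (lp_sum p F) F (1 / p)"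
proof
  let ?G = "lp_sum p F"
  have p0: "0 < p" "p \<noteq> 0"
    using p by auto
  show "0 \<in> carrier ?G"
    by (simp add: lp_sum_iff riesz.carrier_zero riesz.lnorm_zero)
  show "1 / p < 1"
    using p by simp
  show "le ?G g h \<longleftrightarrow> (\<forall>n. le (F n) (g n) (h n))" for g h
    by (simp add: lp_sum_def)
  fix g assume g: "g \<in> carrier ?G"
  show gn: "g n \<in> carrier (F n)" for n
    using g by (simp add: lp_sum_iff)
  have sm: "summable (\<lambda>n. lnorm (F n) (g n) powr p)"
    using g by (simp add: lp_sum_iff)
  have norm_c: "lnorm (F n) (c *\<^sub>R g n) powr p = \<bar>c\<bar> powr p * lnorm (F n) (g n) powr p" for n c
    using gn by (simp add: riesz.lnorm_scaleR powr_mult riesz.lnorm_nonneg)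
  show "c *\<^sub>R g \<in> carrier ?G" for c
    using gn sm by (simp add: lp_sum_iff scaleR_fun_apply norm_c riesz.carrier_closed summable_mult)
  show "lnorm ?G (c *\<^sub>R g) = \<bar>c\<bar> * lnorm ?G g" for c
    using p0 sm by (simp add: lnorm_lp scaleR_fun_apply norm_c suminf_mult powr_mult powr_powr suminf_nonneg)
  show "0 \<le> lnorm ?G g"
    by (simp add: lnorm_lp)
  show "g + h \<in> carrier ?G" if "h \<in> carrier ?G" for h
    using p0(1) g that by (rule lp_add_closed)
  show "h \<in> carrier ?G"
    if "\<And>n. h n \<in> carrier (F n)" "\<And>n. lnorm (F n) (h n) \<le> lnorm (F n) (g n)" for h
    using p0(1) g that by (rule lp_dominated_closed)
  show "lnorm ?G h \<le> lnorm ?G g"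
    if h: "h \<in> carrier ?G" and le: "\<And>n. lnorm (F n) (h n) \<le> lnorm (F n) (g n)" for h
    unfolding lnorm_lp using h p0 le sm
    by (intro powr_mono2 suminf_le) (auto simp: lp_sum_iff riesz.lnorm_nonneg intro!: suminf_nonneg powr_mono2)
  show "(\<lambda>N. lnorm ?G (g - trunc N g)) \<longlonglongrightarrow> 0"
  proof -
    let ?a = "\<lambda>n. lnorm (F n) (g n) powr p"
    have "(\<Sum>n. lnorm (F n) ((g - trunc N g) n) powr p) = suminf ?a - (\<Sum>n<N. ?a n)" for N
    proof -
      have "(\<lambda>n. ?a n - (if n \<in> {..<N} then ?a n else 0)) sums (suminf ?a - (\<Sum>n<N. ?a n))"
        by (intro sums_diff summable_sums[OF sm] sums_If_finite_set) simp
      moreover have "(\<lambda>n. ?a n - (if n \<in> {..<N} then ?a n else 0)) =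
          (\<lambda>n. lnorm (F n) ((g - trunc N g) n) powr p)"
        by (auto simp: trunc_def riesz.lnorm_zero)
      ultimately show ?thesis
        by (simp add: sums_iff)
    qed
    \<comment> \<open>The base tends to 0, so \<open>tendsto_powr'\<close> is used in its second
      alternative, with positive exponent and nonnegative base.\<close>
    moreover have "(\<lambda>N. (suminf ?a - (\<Sum>n<N. ?a n)) powr (1 / p)) \<longlonglongrightarrow> 0 powr (1 / p)"
    proof (intro tendsto_powr' tendsto_const disjI2 conjI always_eventually allI)
      show "(\<lambda>N. suminf ?a - (\<Sum>n<N. ?a n)) \<longlonglongrightarrow> 0"
        using tendsto_diff[OF tendsto_const summable_LIMSEQ[OF sm], of "suminf ?a"] by simp
      show "0 \<le> suminf ?a - (\<Sum>n<N. ?a n)" for N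
        using sum_le_suminf[OF sm, of "{..<N}"] by simp
    qed (use p0 in simp)
    ultimately show ?thesis
      by (simp add: lnorm_lp)
  qed
next
  fix x n assume x: "x \<in> carrier (F n)"
  have "(\<lambda>k. lnorm (F k) (single n x k) powr p) = (\<lambda>k. if k = n then lnorm (F k) x powr p else 0)"
    by (auto simp: single_def riesz.lnorm_zero)
  then have s: "(\<lambda>k. lnorm (F k) (single n x k) powr p) sums (lnorm (F n) x powr p)"
    using sums_single[of n "\<lambda>k. lnorm (F k) x powr p"] by simp
  show "single n x \<in> carrier (lp_sum p F)"
    using s x by (auto simp: lp_sum_iff sums_iff) (auto simp: single_def riesz.carrier_zero)
  show "lnorm (lp_sum p F) (single n x) = lnorm (F n) x"
    using s x p by (simp add: lnorm_lp sums_iff powr_powr riesz.lnorm_nonneg)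
next
  fix e :: "nat \<Rightarrow> nat \<Rightarrow> 'f" and K :: nat
  assume e: "\<And>k. e k \<in> carrier (lp_sum p F)" "\<And>k. lnorm (lp_sum p F) (e k) \<le> 1"
    "\<And>k l n. k \<noteq> l \<Longrightarrow> e k n = 0 \<or> e l n = 0" and K: "0 < K"
  let ?a = "\<lambda>k n. lnorm (F n) (e k n) powr p"
  have sm: "summable (?a k)" for k
    using e(1) by (simp add: lp_sum_iff)
  have sum_le: "suminf (?a k) \<le> 1" for k
  proof -
    have "suminf (?a k) = (suminf (?a k) powr (1 / p)) powr p"
      using p suminf_nonneg[OF sm] by (simp add: powr_powr)
    also have "\<dots> \<le> 1 powr p"
      using e(2)[of k] p by (intro powr_mono2) (auto simp: lnorm_lp)
    finally show ?thesis by simp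
  qed
  \<comment> \<open>By disjointness the left side is one of the terms on the right. Summed over n,
    this bounds the p-th power of the norm by K.\<close>
  have le: "lnorm (F n) ((\<Sum>k<K. e k) n) powr p \<le> (\<Sum>k<K. ?a k n)" for n
  proof -
    obtain k where k: "k < K" "(\<Sum>k<K. e k) n = e k n"
      by (rule disjoint_sum_eq[OF e(3) K])
    have "?a k n \<le> (\<Sum>k<K. ?a k n)"
      using k(1) by (intro member_le_sum) auto
    then show ?thesis
      by (simp only: k(2))
  qed
  have ss: "summable (\<lambda>n. \<Sum>k<K. ?a k n)"
    using sm by (intro summable_sum)
  have sl: "summable (\<lambda>n. lnorm (F n) ((\<Sum>k<K. e k) n) powr p)"
    using le by (intro summable_comparison_test'[OF ss, of 0]) auto
  have "(\<Sum>n. lnorm (F n) ((\<Sum>k<K. e k) n) powr p) \<le> (\<Sum>n. \<Sum>k<K. ?a k n)"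
    by (rule suminf_le[OF le sl ss])
  also have "\<dots> = (\<Sum>k<K. suminf (?a k))"
    by (rule suminf_sum) (rule sm)
  also have "\<dots> \<le> (\<Sum>k<K. 1)"
    by (intro sum_mono sum_le)
  finally show "lnorm (lp_sum p F) (\<Sum>k<K. e k) \<le> real K powr (1 / p)"
    unfolding lnorm_lp using p by (intro powr_mono2) (auto intro!: suminf_nonneg[OF sl])
qed

end

section \<open>Boundedness of positive multilinear operators\<close>

lemma multilinear_closed: "multilinear I E F A \<Longrightarrow> x \<in> prod_space I E \<Longrightarrow> A x \<in> carrier F"
  by (simp add: multilinear_def)

lemma multilinear_add:
  "\<lbrakk>multilinear I E F A; x \<in> prod_space I E; i \<in> I; a \<in> carrier (E i); b \<in> carrier (E i)\<rbrakk>
    \<Longrightarrow> A (x(i := a + b)) = A (x(i := a)) + A (x(i := b))"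
  unfolding multilinear_def by blast

lemma multilinear_scaleR:
  "\<lbrakk>multilinear I E F A; x \<in> prod_space I E; i \<in> I; a \<in> carrier (E i)\<rbrakk>
    \<Longrightarrow> A (x(i := c *\<^sub>R a)) = c *\<^sub>R A (x(i := a))"
  unfolding multilinear_def by blast

lemma positive_multilinear_pos:
  assumes "positive_multilinear I E F A" "x \<in> prod_space I E" "\<And>i. i \<in> I \<Longrightarrow> x i \<in> pos_cone (E i)"
  shows "A x \<in> pos_cone F"
  using assms unfolding positive_multilinear_def multilinear_def by (simp add: pos_cone_def)

lemma prod_space_upd:
  "\<lbrakk>x \<in> prod_space I E; i \<in> I; a \<in> carrier (E i)\<rbrakk> \<Longrightarrow> x(i := a) \<in> prod_space I E"
  by (auto simp: PiE_iff extensional_def)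

text \<open>Closure of the codomain under sums and multiples is asked for directly, because the
  lemma is applied to a sequence sum, which is known only through
  \<open>riesz_sequence_sum\<close>.\<close>

lemma regular_imp_multilinear:
  assumes A: "regular_multilinear I E F A"
    and add: "\<And>u v. \<lbrakk>u \<in> carrier F; v \<in> carrier F\<rbrakk> \<Longrightarrow> u + v \<in> carrier F"
    and scale: "\<And>u c. u \<in> carrier F \<Longrightarrow> c *\<^sub>R u \<in> carrier F"
    and E: "\<And>i. i \<in> I \<Longrightarrow> normed_riesz_space (E i)"
  shows "multilinear I E F A"
proof -
  obtain P Q where P: "multilinear I E F P" and Q: "multilinear I E F Q"
    and PQ: "\<And>x. x \<in> prod_space I E \<Longrightarrow> A x = P x - Q x"
    using A unfolding regular_multilinear_def positive_multilinear_def by blast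
  show ?thesis
    unfolding multilinear_def
  proof (intro conjI ballI allI)
    fix x assume x: "x \<in> prod_space I E"
    have "P x + (- 1) *\<^sub>R Q x \<in> carrier F"
      using x by (intro add scale multilinear_closed[OF P] multilinear_closed[OF Q])
    then show "A x \<in> carrier F"
      using PQ[OF x] by simp
    fix i a assume i: "i \<in> I" "a \<in> carrier (E i)"
    interpret normed_riesz_space "E i"
      using i by (intro E)
    show "A (x(i := c *\<^sub>R a)) = c *\<^sub>R A (x(i := a))" for c
      using x i prod_space_upd[of x I E i] multilinear_scaleR[OF P x i] multilinear_scaleR[OF Q x i]
      by (simp add: PQ carrier_closed scaleR_diff_right)
    fix b assume b: "b \<in> carrier (E i)"
    show "A (x(i := a + b)) = A (x(i := a)) + A (x(i := b))"
      using x i b prod_space_upd[of x I E i] multilinear_add[OF P x i b] multilinear_add[OF Q x i b]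
      by (simp add: PQ carrier_closed)
  qed
qed

lemma multilinear_zero:
  assumes "multilinear I E F A" "x \<in> prod_space I E" "i \<in> I" "x i = 0"
  shows "A x = 0"
proof -
  have "A (x(i := 0 *\<^sub>R x i)) = 0 *\<^sub>R A (x(i := x i))"
    using assms(2,3) by (intro multilinear_scaleR[OF assms(1,2,3)]) (rule PiE_mem)
  moreover have "x(i := 0 *\<^sub>R x i) = x"
    using assms(4) by (auto simp: fun_eq_iff)
  ultimately show ?thesis
    by simp
qed

text \<open>J is the set of variables already scaled. The case J = I serves to normalise arguments
  and to shrink them by a common factor.\<close>

lemma multilinear_scaleR_prod:
  assumes A: "multilinear I E F A" and x: "x \<in> prod_space I E" and J: "finite J" "J \<subseteq> I"
    and E: "\<And>i. i \<in> I \<Longrightarrow> normed_riesz_space (E i)"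
  shows "A (\<lambda>i. if i \<in> J then c i *\<^sub>R x i else x i) = (\<Prod>i\<in>J. c i) *\<^sub>R A x"
  using J
proof (induction J rule: finite_induct)
  case (insert j J)
  let ?y = "\<lambda>i. if i \<in> J then c i *\<^sub>R x i else x i"
  have y: "?y \<in> prod_space I E"
    using x insert.prems by (auto simp: PiE_iff extensional_def normed_riesz_space.carrier_scaleR[OF E])
  have j: "j \<in> I" "x j \<in> carrier (E j)"
    using x insert.prems by auto
  have "(\<lambda>i. if i \<in> insert j J then c i *\<^sub>R x i else x i) = ?y(j := c j *\<^sub>R x j)"
    by auto
  moreover have "?y(j := x j) = ?y"
    using insert.hyps by auto
  ultimately have "A (\<lambda>i. if i \<in> insert j J then c i *\<^sub>R x i else x i) = c j *\<^sub>R A ?y"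
    using multilinear_scaleR[OF A y j, of "c j"] by (simp only:)
  then show ?case
    using insert by simp
qed simp

text \<open>The entries x j are replaced by y j one at a time. Each increment is the value of A with
  y j - x j in place j, where all other entries are positive too.\<close>

lemma positive_multilinear_mono:
  assumes A: "positive_multilinear I E F A" and F: "normed_riesz_space F" and fin: "finite I"
    and E: "\<And>i. i \<in> I \<Longrightarrow> normed_riesz_space (E i)"
    and x: "x \<in> prod_space I E" and y: "y \<in> prod_space I E"
    and x0: "\<And>i. i \<in> I \<Longrightarrow> x i \<in> pos_cone (E i)"
    and xy: "\<And>i. i \<in> I \<Longrightarrow> le (E i) (x i) (y i)"
  shows "le F (A x) (A y)"
proof -
  interpret F: normed_riesz_space F by (rule F)
  have ml: "multilinear I E F A"
    using A by (simp add: positive_multilinear_def)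
  have d: "y i - x i \<in> pos_cone (E i)" if "i \<in> I" for i
    using xy[OF that] x y that normed_riesz_space.le_iff_pos[OF E[OF that]] by auto
  have "le F (A x) (A (\<lambda>i. if i \<in> J then y i else x i))" if "finite J" "J \<subseteq> I" for J
    using that
  proof (induction J rule: finite_induct)
    case empty
    then show ?case
      using F.le_refl multilinear_closed[OF ml x] by simp
  next
    case (insert j J)
    let ?m = "\<lambda>i. if i \<in> J then y i else x i"
    have m: "?m \<in> prod_space I E" "(\<lambda>i. if i \<in> insert j J then y i else x i) \<in> prod_space I E"
      using x y insert.prems by (auto simp: PiE_iff extensional_def)
    have j: "j \<in> I" "x j \<in> carrier (E j)" "y j - x j \<in> carrier (E j)"
      using x insert.prems d[of j] by (auto simp: pos_cone_def)
    have pos: "?m i \<in> pos_cone (E i)" if "i \<in> I" for i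
      using normed_riesz_space.pos_add[OF E[OF that] x0[OF that] d[OF that]] x0[OF that] by simp
    have "?m(j := x j) = ?m" "?m(j := x j + (y j - x j)) = (\<lambda>i. if i \<in> insert j J then y i else x i)"
      using insert.hyps by auto
    then have eq: "A (\<lambda>i. if i \<in> insert j J then y i else x i) = A ?m + A (?m(j := y j - x j))"
      using multilinear_add[OF ml m(1) j] by (simp only:)
    have "le F 0 (A (?m(j := y j - x j)))"
      using A prod_space_upd[OF m(1) j(1,3)] pos d[OF j(1)]
      unfolding positive_multilinear_def pos_cone_def by auto
    then have "A (\<lambda>i. if i \<in> insert j J then y i else x i) - A ?m \<in> pos_cone F"
      using eq multilinear_closed[OF ml prod_space_upd[OF m(1) j(1,3)]] by (simp add: pos_cone_def)
    then have "le F (A ?m) (A (\<lambda>i. if i \<in> insert j J then y i else x i))"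
      by (subst F.le_iff_pos) (use multilinear_closed[OF ml] m in auto)
    then show ?case
      using insert.IH insert.prems F.le_trans multilinear_closed[OF ml] x m by (meson insert_subset)
  qed
  moreover have "(\<lambda>i. if i \<in> I then y i else x i) = y"
    using x y by (auto simp: PiE_iff extensional_def fun_eq_iff)
  ultimately show ?thesis
    using fin by (metis order_refl)
qed

text \<open>x is the sum of the series, which converges by completeness. That it dominates every
  term is closedness of the cone, proved here by hand: for large n the positive part of a term minus
  x lies below |s n - x|, whose norm tends to 0.\<close>

lemma (in banach_lattice) positive_series_bound:
  assumes a: "\<And>k. a k \<in> pos_cone L" "\<And>k. lnorm L (a k) \<le> 1"
  obtains x where "x \<in> pos_cone L" "\<And>k. (1/2)^k *\<^sub>R a k \<sqsubseteq> x"
proof -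
  interpret r: normed_riesz_space L by (rule normed_riesz)
  define s where "s n = (\<Sum>k<n. (1/2)^k *\<^sub>R a k)" for n :: nat
  have b: "(1/2)^k *\<^sub>R a k \<in> pos_cone L" for k
    by (intro r.pos_scaleR a) simp
  have s: "s n \<in> carrier L" for n
    unfolding s_def by (intro subspace_sum subspace_carrier r.pos_in_carrier b)
  have s_step: "s (Suc n) = s n + (1/2)^n *\<^sub>R a n" for n
    by (simp add: s_def)
  \<comment> \<open>The right side is the geometric sum of (1/2)^k for k from i to i + d -
    1.\<close>
  have cauchy: "lnorm L (s (i + d) - s i) \<le> 2 * (1/2)^i - 2 * (1/2)^(i + d)" for i d
  proof (induction d)
    case 0
    then show ?case by (simp add: r.lnorm_zero)
  next
    case (Suc d)
    have eq: "s (i + Suc d) - s i = (s (i + d) - s i) + (1/2)^(i + d) *\<^sub>R a (i + d)"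
      by (simp add: s_step)
    have "lnorm L ((1/2)^(i + d) *\<^sub>R a (i + d)) \<le> (1/2)^(i + d) * 1"
      unfolding r.lnorm_scaleR[OF r.pos_in_carrier[OF a(1)]]
      using mult_left_mono[OF a(2), of "(1/2)^(i + d)"] by simp
    then have "lnorm L (s (i + Suc d) - s i) \<le> lnorm L (s (i + d) - s i) + (1/2)^(i + d)"
      unfolding eq using r.lnorm_triangle[OF r.carrier_diff[OF s s] r.pos_in_carrier[OF b], of "i + d" i "i + d"]
      by linarith
    then show ?case
      using Suc by simp
  qed
  have cauchy': "lnorm L (s i - s j) \<le> 2 * (1/2)^N" if "N \<le> i" "N \<le> j" for i j N
  proof -
    have *: "lnorm L (s l - s k) \<le> 2 * (1/2)^N" if "k \<le> l" "N \<le> k" for k l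
    proof -
      have "(1/2::real)^k \<le> (1/2)^N"
        using that by (intro power_decreasing) auto
      moreover have "lnorm L (s l - s k) \<le> 2 * (1/2)^k - 2 * (1/2)^l" "0 \<le> (1/2::real)^l"
        using cauchy[of k "l - k"] that by simp_all
      ultimately show ?thesis
        by linarith
    qed
    show ?thesis
      using *[of i j] *[of j i] that r.lnorm_minus[OF r.carrier_diff[OF s s], of i j]
      by (cases "i \<le> j") auto
  qed
  have "\<exists>N. \<forall>i\<ge>N. \<forall>j\<ge>N. lnorm L (s i - s j) < e" if e: "e > 0" for e
  proof -
    obtain N where "(1/2::real)^N < e / 2"
      using real_arch_pow_inv[of "e / 2" "1/2"] e by auto
    then show ?thesis
      using cauchy'[of N] by (intro exI[of _ N]) (force intro: le_less_trans)
  qed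
  then obtain x where x: "x \<in> carrier L" "(\<lambda>n. lnorm L (s n - x)) \<longlonglongrightarrow> 0"
    using complete[of s] s by blast
  have upper: "x - (1/2)^k *\<^sub>R a k \<in> pos_cone L" for k
  proof -
    let ?d = "(1/2)^k *\<^sub>R a k - x"
    have d: "?d \<in> carrier L"
      using b[of k] x by (simp add: r.carrier_closed r.pos_in_carrier)
    obtain p q where pq: "p \<in> pos_cone L" "q \<in> pos_cone L" "?d = p - q" "modulus L ?d = p + q"
      using r.pos_decomposition[OF d] by metis
    have le: "lnorm L p \<le> lnorm L (s n - x)" if n: "k < n" for n
    proof -
      let ?t = "modulus L (s n - x)"
      have t: "s n - x \<in> carrier L" "?t \<in> carrier L" "?t \<in> pos_cone L"
        using s x by (auto simp: r.carrier_closed r.modulus_in_carrier r.modulus_pos)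
      \<comment> \<open>For n > k the term is one of the positive summands of \<open>s n\<close>;
        therefore \<open>?d\<close> is below \<open>s n - x\<close>, which is below
        \<open>?t\<close>.\<close>
      have "s n - (1/2)^k *\<^sub>R a k \<in> pos_cone L"
      proof -
        have "s n - (1/2)^k *\<^sub>R a k = (\<Sum>l\<in>{..<n} - {k}. (1/2)^l *\<^sub>R a l)"
          using n by (simp add: s_def sum_diff1)
        also have "\<dots> \<in> pos_cone L"
          by (intro r.pos_sum b)
        finally show ?thesis .
      qed
      then have "?t - (s n - x) + (s n - (1/2)^k *\<^sub>R a k) \<in> pos_cone L"
        by (intro r.pos_add r.modulus_minus_pos t)
      then have td: "?t - ?d \<in> pos_cone L"
        by (simp add: algebra_simps)
      \<comment> \<open>As \<open>?d\<close> is p - q and its modulus is p + q, subtracting this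
        modulus from \<open>?t + ?t - ?d\<close> leaves twice \<open>?t - p\<close>. So it is enough
        that \<open>?t + ?t - ?d\<close> dominates both \<open>?d\<close> and its negative.\<close>
      have "?t + ?t - ?d \<in> carrier L"
        by (intro r.carrier_closed d t)
      then have "(?t + ?t - ?d) - modulus L ?d \<in> pos_cone L"
        using r.pos_add[OF td td] r.pos_add[OF t(3) t(3)]
        by (intro r.modulus_least_pos d) (auto simp: algebra_simps)
      moreover have "(?t + ?t - ?d) - modulus L ?d = (?t - p) + (?t - p)"
        unfolding pq(4) unfolding pq(3) by (simp add: algebra_simps)
      ultimately have "?t - p \<in> pos_cone L"
        by (metis r.pos_half)
      then have "lnorm L p \<le> lnorm L ?t"
        using pq(1) t by (intro r.lnorm_pos_mono) (auto simp: r.le_iff_pos r.pos_in_carrier)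
      then show ?thesis
        using t by (simp add: r.lnorm_modulus)
    qed
    have "lnorm L p \<le> 0"
      using le by (intro tendsto_lowerbound[OF x(2)] eventually_sequentiallyI[of "Suc k"]) auto
    then have "p = 0"
      using r.lnorm_nonneg[of p] r.lnorm_eq_0_iff[of p] r.pos_in_carrier[OF pq(1)] by simp
    then have "q = x - (1/2)^k *\<^sub>R a k"
      using pq(3) by (simp add: algebra_simps)
    then show ?thesis
      using pq(2) by simp
  qed
  have "x \<in> pos_cone L"
    using r.pos_add[OF upper[of 0] b[of 0]] by simp
  then show ?thesis
    by (rule that) (simp add: r.le_iff_pos[OF r.pos_in_carrier[OF b] x(1)] upper)
qed

text \<open>
  A gliding hump: an unbounded \<open>A\<close> has \<open>u k \<ge> 0\<close> on the unit spheres with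
  \<open>\<parallel>A (u k)\<parallel> > k * (2 ^ card I) ^ k\<close>, and \<open>X i \<ge> (1/2)^k * u k i\<close> for all \<open>k\<close> forces \<open>\<parallel>A X\<parallel> > k\<close>.
\<close>

lemma (in riesz_sequence_sum) positive_multilinear_bounded:
  assumes A: "positive_multilinear I E G A" and fin: "finite I"
    and E: "\<And>i. i \<in> I \<Longrightarrow> banach_lattice (E i)"
  shows "\<exists>C\<ge>0. \<forall>x\<in>prod_space I E. (\<forall>i\<in>I. x i \<in> pos_cone (E i)) \<longrightarrow>
    lnorm G (A x) \<le> C * (\<Prod>i\<in>I. lnorm (E i) (x i))"
proof (rule ccontr)
  assume contr: "\<not> ?thesis"
  have E': "normed_riesz_space (E i)" if "i \<in> I" for i
    using E[OF that] by (rule banach_lattice.normed_riesz)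
  have ml: "multilinear I E G A"
    using A by (simp add: positive_multilinear_def)
  \<comment> \<open>A counterexample x to the constant C has no entry of norm 0, since otherwise
    both sides of the bound vanish. So its entries can be normalised, and homogeneity moves the
    product of their norms to the other side.\<close>
  have "\<exists>u\<in>prod_space I E. (\<forall>i\<in>I. u i \<in> pos_cone (E i) \<and> lnorm (E i) (u i) \<le> 1) \<and> C < lnorm G (A u)"
    if "0 \<le> C" for C
  proof -
    obtain x where x: "x \<in> prod_space I E" "\<And>i. i \<in> I \<Longrightarrow> x i \<in> pos_cone (E i)"
      "C * (\<Prod>i\<in>I. lnorm (E i) (x i)) < lnorm G (A x)"
      using contr \<open>0 \<le> C\<close> by (meson not_le)
    have xc: "x i \<in> carrier (E i)" if "i \<in> I" for i
      using x(1) that by auto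
    have pos: "0 < lnorm (E i) (x i)" if i: "i \<in> I" for i
    proof (rule ccontr)
      assume "\<not> ?thesis"
      then have 0: "lnorm (E i) (x i) = 0"
        using normed_riesz_space.lnorm_nonneg[OF E'[OF i] xc[OF i]] by simp
      then have "x i = 0"
        using normed_riesz_space.lnorm_eq_0_iff[OF E'[OF i] xc[OF i]] by simp
      then have "A x = 0"
        using multilinear_zero[OF ml x(1) i] by simp
      moreover have "(\<Prod>i\<in>I. lnorm (E i) (x i)) = 0"
        using fin i 0 by (intro prod_zero) auto
      ultimately show False
        using x(3) lnorm_of_zero by simp
    qed
    let ?c = "\<lambda>i. 1 / lnorm (E i) (x i)"
    let ?u = "\<lambda>i. if i \<in> I then ?c i *\<^sub>R x i else x i"
    have "A ?u = (\<Prod>i\<in>I. ?c i) *\<^sub>R A x"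
      by (rule multilinear_scaleR_prod[OF ml x(1) fin order_refl E'])
    moreover have P: "0 < (\<Prod>i\<in>I. lnorm (E i) (x i))"
      using pos by (rule prod_pos)
    moreover have "(\<Prod>i\<in>I. ?c i) = 1 / (\<Prod>i\<in>I. lnorm (E i) (x i))"
      by (simp add: prod_dividef)
    ultimately have "lnorm G (A ?u) = lnorm G (A x) / (\<Prod>i\<in>I. lnorm (E i) (x i))"
      using lnorm_homogeneous[OF multilinear_closed[OF ml x(1)]] by simp
    then have u1: "C < lnorm G (A ?u)"
      using x(3) P by (simp add: pos_less_divide_eq)
    have u2: "?u \<in> prod_space I E"
      using x(1) by (auto simp: PiE_iff extensional_def normed_riesz_space.carrier_scaleR[OF E'])
    have u3: "?u i \<in> pos_cone (E i)" "lnorm (E i) (?u i) \<le> 1" if i: "i \<in> I" for i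
      using i pos[OF i] x(2)[OF i] normed_riesz_space.lnorm_scaleR[OF E'[OF i] xc[OF i]]
      by (auto intro!: normed_riesz_space.pos_scaleR[OF E'])
    show ?thesis
      by (intro bexI[of _ ?u] conjI ballI u1 u2 u3)
  qed
  \<comment> \<open>The factor (2 ^ card I) ^ k makes up for the later scaling of all variables by
    (1/2)^k.\<close>
  then have "\<exists>u\<in>prod_space I E. (\<forall>i\<in>I. u i \<in> pos_cone (E i) \<and> lnorm (E i) (u i) \<le> 1) \<and>
      real k * (2 ^ card I) ^ k < lnorm G (A u)" for k
    by simp
  then obtain u where u: "\<And>k. u k \<in> prod_space I E" "\<And>k i. i \<in> I \<Longrightarrow> u k i \<in> pos_cone (E i)"
    "\<And>k i. i \<in> I \<Longrightarrow> lnorm (E i) (u k i) \<le> 1" "\<And>k. real k * (2 ^ card I) ^ k < lnorm G (A (u k))"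
    by metis
  have "\<exists>x. x \<in> pos_cone (E i) \<and> (\<forall>k. le (E i) ((1/2)^k *\<^sub>R u k i) x)" if i: "i \<in> I" for i
    using banach_lattice.positive_series_bound[OF E[OF i], of "\<lambda>k. u k i"] u(2,3) i by metis
  then obtain X where X: "\<And>i. i \<in> I \<Longrightarrow> X i \<in> pos_cone (E i)"
    "\<And>i k. i \<in> I \<Longrightarrow> le (E i) ((1/2)^k *\<^sub>R u k i) (X i)"
    by metis
  define Y where "Y = restrict X I"
  have Y: "Y \<in> prod_space I E"
    using X(1) by (auto simp: Y_def pos_cone_def)
  have "real k \<le> lnorm G (A Y)" for k
  proof -
    let ?v = "\<lambda>i. if i \<in> I then (1/2)^k *\<^sub>R u k i else u k i"
    have v: "?v \<in> prod_space I E"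
      using u(1)[of k] by (auto simp: PiE_iff extensional_def normed_riesz_space.carrier_scaleR[OF E'])
    have vp: "?v i \<in> pos_cone (E i)" if "i \<in> I" for i
      using that u(2) by (auto intro!: normed_riesz_space.pos_scaleR[OF E'])
    have Av: "A ?v = ((1/2)^k)^card I *\<^sub>R A (u k)"
      using multilinear_scaleR_prod[OF ml u(1) fin order_refl E', of "\<lambda>_. (1/2)^k"] by simp
    \<comment> \<open>Monotonicity is applied in each coordinate, where \<open>F n\<close> is a
      normed Riesz space, and the results are reassembled in G.\<close>
    have "le (F n) (A ?v n) (A Y n)" for n
    proof (rule positive_multilinear_mono[where I = I and E = E and A = "\<lambda>x. A x n"])
      show "positive_multilinear I E (F n) (\<lambda>x. A x n)"
        using A unfolding positive_multilinear_def multilinear_def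
        by (auto simp: coordinate_closed le_coordinatewise scaleR_fun_apply)
      show "le (E i) (?v i) (Y i)" if "i \<in> I" for i
        using X(2) that by (simp add: Y_def)
    qed (use riesz fin E' v Y vp in auto)
    then have le: "le G (A ?v) (A Y)"
      by (simp add: le_coordinatewise)
    have "A ?v \<in> pos_cone G"
      using A v vp by (rule positive_multilinear_pos)
    then have "lnorm G (A ?v) \<le> lnorm G (A Y)"
      using le multilinear_closed[OF ml Y] by (intro lnorm_pos_mono)
    moreover have "real k \<le> lnorm G (A ?v)"
    proof -
      have "real k = ((1/2)^k)^card I * (real k * (2 ^ card I) ^ k)"
        by (simp add: power_one_over field_simps flip: power_mult)
      also have "\<dots> \<le> ((1/2)^k)^card I * lnorm G (A (u k))"
        using u(4)[of k] by (intro mult_left_mono) auto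
      also have "\<dots> = lnorm G (A ?v)"
        unfolding Av by (simp add: lnorm_homogeneous[OF multilinear_closed[OF ml u(1)]])
      finally show ?thesis .
    qed
    ultimately show ?thesis by simp
  qed
  then show False
    using reals_Archimedean2[of "lnorm G (A Y)"] by (meson not_less)
qed

section \<open>Aron-Berner extensions of bounded forms\<close>

text \<open>The constant is a parameter because it has to be followed through all steps: for the
  form y composed with A it is proportional to the norm of y, and this makes the extension bounded
  as a functional of y.\<close>

definition bounded_form ::
  "nat set \<Rightarrow> (nat \<Rightarrow> 'e::real_vector normed_order) \<Rightarrow> real \<Rightarrow> ((nat \<Rightarrow> 'e) \<Rightarrow> real) \<Rightarrow> bool" where
  "bounded_form I E K B \<longleftrightarrow>
    (\<forall>x\<in>prod_space I E. \<forall>i\<in>I. \<forall>a\<in>carrier (E i). \<forall>b\<in>carrier (E i).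
       B (x(i := a + b)) = B (x(i := a)) + B (x(i := b))) \<and>
    (\<forall>x\<in>prod_space I E. \<forall>i\<in>I. \<forall>a\<in>carrier (E i). \<forall>c. B (x(i := c *\<^sub>R a)) = c * B (x(i := a))) \<and>
    (\<forall>x\<in>prod_space I E. \<bar>B x\<bar> \<le> K * (\<Prod>i\<in>I. lnorm (E i) (x i)))"

lemma bounded_form_add:
  "\<lbrakk>bounded_form I E K B; x \<in> prod_space I E; i \<in> I; a \<in> carrier (E i); b \<in> carrier (E i)\<rbrakk>
    \<Longrightarrow> B (x(i := a + b)) = B (x(i := a)) + B (x(i := b))"
  and bounded_form_scaleR:
  "\<lbrakk>bounded_form I E K B; x \<in> prod_space I E; i \<in> I; a \<in> carrier (E i)\<rbrakk>
    \<Longrightarrow> B (x(i := c *\<^sub>R a)) = c * B (x(i := a))"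
  and bounded_form_bound:
  "\<lbrakk>bounded_form I E K B; x \<in> prod_space I E\<rbrakk> \<Longrightarrow> \<bar>B x\<bar> \<le> K * (\<Prod>i\<in>I. lnorm (E i) (x i))"
  unfolding bounded_form_def by blast+

text \<open>The argument that \<open>apply_bidual\<close> hands to the bidual element, for the
  variable j.\<close>

definition slice ::
  "(nat \<Rightarrow> 'e::real_vector normed_order) \<Rightarrow> nat \<Rightarrow> ((nat \<Rightarrow> 'e) \<Rightarrow> real) \<Rightarrow> (nat \<Rightarrow> 'e) \<Rightarrow> 'e \<Rightarrow> real" where
  "slice E j B x = (\<lambda>t. if t \<in> carrier (E j) then B (x(j := t)) else 0)"

lemma prod_space_insert_upd:
  "\<lbrakk>x \<in> prod_space I E; t \<in> carrier (E j)\<rbrakk> \<Longrightarrow> x(j := t) \<in> prod_space (insert j I) E"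
  by (auto simp: PiE_iff extensional_def)

context
  fixes I :: "nat set" and E :: "nat \<Rightarrow> 'e::real_vector normed_order" and j :: nat
    and K :: real and B :: "(nat \<Rightarrow> 'e) \<Rightarrow> real"
  assumes B: "bounded_form (insert j I) E K B" and K: "0 \<le> K" and j: "j \<notin> I" and I: "finite I"
    and E: "\<And>i. i \<in> insert j I \<Longrightarrow> normed_riesz_space (E i)"
begin

interpretation Ej: normed_riesz_space "E j"
  by (rule E) simp

lemma slice_bound:
  assumes x: "x \<in> prod_space I E" and t: "t \<in> carrier (E j)"
  shows "\<bar>slice E j B x t\<bar> \<le> K * (\<Prod>i\<in>I. lnorm (E i) (x i)) * lnorm (E j) t"
proof -
  have "(\<Prod>i\<in>insert j I. lnorm (E i) ((x(j := t)) i)) = lnorm (E j) t * (\<Prod>i\<in>I. lnorm (E i) ((x(j := t)) i))"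
    using I j by simp
  also have "(\<Prod>i\<in>I. lnorm (E i) ((x(j := t)) i)) = (\<Prod>i\<in>I. lnorm (E i) (x i))"
    using j by (intro prod.cong) auto
  finally show ?thesis
    using bounded_form_bound[OF B prod_space_insert_upd[where j = j, OF x t]] t
    by (simp add: slice_def mult_ac)
qed

lemma slice_in_dual:
  assumes x: "x \<in> prod_space I E"
  shows "slice E j B x \<in> carrier (dual_lattice (E j))"
proof -
  have y: "x(j := 0) \<in> prod_space (insert j I) E"
    using prod_space_insert_upd[where j = j, OF x Ej.carrier_zero] .
  show ?thesis
    unfolding dual_iff
  proof (intro conjI ballI allI impI)
    show "\<exists>K. \<forall>t\<in>carrier (E j). \<bar>slice E j B x t\<bar> \<le> K * lnorm (E j) t"
      using slice_bound[OF x] by blast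
    show "slice E j B x (s + t) = slice E j B x s + slice E j B x t"
      if "s \<in> carrier (E j)" "t \<in> carrier (E j)" for s t
      using bounded_form_add[OF B y _ that] that by (simp add: slice_def Ej.carrier_closed)
    show "slice E j B x (c *\<^sub>R t) = c * slice E j B x t" if "t \<in> carrier (E j)" for c t
      using bounded_form_scaleR[OF B y _ that, of c] that by (simp add: slice_def Ej.carrier_closed)
  qed (simp add: slice_def)
qed

lemma prod_lnorm_nonneg:
  assumes "x \<in> prod_space I E"
  shows "0 \<le> (\<Prod>i\<in>I. lnorm (E i) (x i))"
  using assms normed_riesz_space.lnorm_nonneg[OF E] by (intro prod_nonneg) auto

lemma slice_norm:
  assumes x: "x \<in> prod_space I E"
  shows "lnorm (dual_lattice (E j)) (slice E j B x) \<le> K * (\<Prod>i\<in>I. lnorm (E i) (x i))"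
proof (rule Ej.dual_norm_le)
  show KP: "0 \<le> K * (\<Prod>i\<in>I. lnorm (E i) (x i))"
    using K prod_lnorm_nonneg[OF x] by simp
  show "\<bar>slice E j B x t\<bar> \<le> K * (\<Prod>i\<in>I. lnorm (E i) (x i))"
    if "t \<in> carrier (E j)" "lnorm (E j) t \<le> 1" for t
    using slice_bound[OF x that(1)] mult_left_mono[OF that(2) KP] by simp
qed

text \<open>A slice depends linearly on the other variables, since updates at i and j commute, and
  \<open>slice_norm\<close> bounds its dual norm. Applying z contributes the norm of z to the
  constant.\<close>

lemma bounded_form_extend:
  assumes z: "z \<in> carrier (bidual (E j))"
    and B': "\<And>x. x \<in> prod_space I E \<Longrightarrow> B' x = z (slice E j B x)"
  shows "bounded_form I E (K * lnorm (bidual (E j)) z) B'"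
  unfolding bounded_form_def
proof (intro conjI ballI allI)
  interpret Dj: normed_riesz_space "dual_lattice (E j)"
    by (rule Ej.dual_normed_riesz)
  fix x assume x: "x \<in> prod_space I E"
  have "\<bar>z (slice E j B x)\<bar> \<le> lnorm (bidual (E j)) z * lnorm (dual_lattice (E j)) (slice E j B x)"
    using z slice_in_dual[OF x] by (rule Dj.dual_norm_bound)
  also have "\<dots> \<le> lnorm (bidual (E j)) z * (K * (\<Prod>i\<in>I. lnorm (E i) (x i)))"
    using slice_norm[OF x] Dj.dual_norm_nonneg[OF z] by (intro mult_left_mono)
  finally show "\<bar>B' x\<bar> \<le> K * lnorm (bidual (E j)) z * (\<Prod>i\<in>I. lnorm (E i) (x i))"
    using B'[OF x] by (simp add: mult_ac)
  fix i a assume i: "i \<in> I" and a: "a \<in> carrier (E i)"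
  have ij: "i \<noteq> j"
    using i j by auto
  have xt: "x(j := t) \<in> prod_space (insert j I) E" if "t \<in> carrier (E j)" for t
    using prod_space_insert_upd[where j = j, OF x that] .
  have comm: "x(i := c, j := t) = x(j := t, i := c)" for c t
    using ij by (rule fun_upd_twist)
  interpret Ei: normed_riesz_space "E i"
    using i by (intro E) simp
  have B'_upd: "B' (x(i := c)) = z (slice E j B (x(i := c)))" if "c \<in> carrier (E i)" for c
    using B' prod_space_upd[of x I E i c] x i that by blast
  have sd: "slice E j B (x(i := c)) \<in> carrier (dual_lattice (E j))" if "c \<in> carrier (E i)" for c
    using slice_in_dual prod_space_upd[of x I E i c] x i that by blast
  show "B' (x(i := c *\<^sub>R a)) = c * B' (x(i := a))" for c
  proof -
    have "slice E j B (x(i := c *\<^sub>R a)) = c *\<^sub>R slice E j B (x(i := a))"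
      using bounded_form_scaleR[OF B xt _ a] i by (auto simp: slice_def scaleR_fun_def comm)
    then show ?thesis
      using a dual_scaleR[OF z sd[OF a]] by (simp add: B'_upd Ei.carrier_closed)
  qed
  fix b assume b: "b \<in> carrier (E i)"
  show "B' (x(i := a + b)) = B' (x(i := a)) + B' (x(i := b))"
  proof -
    have "slice E j B (x(i := a + b)) = slice E j B (x(i := a)) + slice E j B (x(i := b))"
      using bounded_form_add[OF B xt _ a b] i by (auto simp: slice_def comm)
    then have "z (slice E j B (x(i := a + b))) = z (slice E j B (x(i := a))) + z (slice E j B (x(i := b)))"
      using dual_add[OF z sd[OF a] sd[OF b]] by (simp only:)
    then show ?thesis
      using a b by (simp add: B'_upd Ei.carrier_closed)
  qed
qed

end

lemma bidual_lincomb: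
  assumes "z \<in> carrier (bidual L)" "f \<in> carrier (dual_lattice L)" "g \<in> carrier (dual_lattice L)"
  shows "z (\<alpha> *\<^sub>R f + \<beta> *\<^sub>R g) = \<alpha> * z f + \<beta> * z g"
  using assms dual_add[OF assms(1)] dual_scaleR[OF assms(1)] subspace_scale[OF subspace_dual] by metis

section \<open>Iterated application of bidual elements to a bounded form\<close>

context
  fixes m :: nat and E :: "nat \<Rightarrow> 'e::real_vector normed_order" and \<rho> :: "nat \<Rightarrow> nat"
  assumes E: "\<forall>i\<in>{1..m}. normed_riesz_space (E i)" and \<rho>: "\<rho> permutes {1..m}"
begin

lemma permuted_index: "k < m \<Longrightarrow> \<rho> (Suc k) \<in> {1..m}"
  using permutes_in_image[OF \<rho>, of "Suc k"] by auto

lemma remaining_Suc: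
  assumes "k < m"
  shows "remaining m \<rho> k = insert (\<rho> (Suc k)) (remaining m \<rho> (Suc k))"
    and "\<rho> (Suc k) \<notin> \<rho> ` {1..k}"
proof -
  show *: "\<rho> (Suc k) \<notin> \<rho> ` {1..k}"
    by (simp add: inj_image_mem_iff[OF permutes_inj[OF \<rho>]])
  show "remaining m \<rho> k = insert (\<rho> (Suc k)) (remaining m \<rho> (Suc k))"
  proof -
    have eq: "\<rho> ` {1..Suc k} = insert (\<rho> (Suc k)) (\<rho> ` {1..k})"
      by (simp add: atLeastAtMostSuc_conv)
    show ?thesis
      unfolding remaining_def eq using * permuted_index[OF assms]
      by (subst Diff_insert, intro insert_Diff[symmetric]) simp
  qed
qed

lemma remaining_removed: "0 < k \<Longrightarrow> \<rho> k \<notin> remaining m \<rho> k"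
  by (auto simp: remaining_def)

lemma remaining_finite: "finite (remaining m \<rho> k)"
  and remaining_subset: "remaining m \<rho> k \<subseteq> {1..m}"
  by (auto simp: remaining_def)

lemma remaining_0: "remaining m \<rho> 0 = {1..m}"
  and remaining_all: "remaining m \<rho> m = {}"
  using permutes_image[OF \<rho>] by (auto simp: remaining_def)

lemma apply_biduals_Suc:
  "x \<in> prod_space (remaining m \<rho> (Suc k)) E \<Longrightarrow>
    apply_biduals m E \<rho> z (Suc k) B x = z (\<rho> (Suc k)) (slice E (\<rho> (Suc k)) (apply_biduals m E \<rho> z k B) x)"
  by (simp add: apply_bidual_def slice_def)

lemma bidual_component:
  "\<lbrakk>z \<in> prod_space {1..m} (\<lambda>i. bidual (E i)); k < m\<rbrakk> \<Longrightarrow> z (\<rho> (Suc k)) \<in> carrier (bidual (E (\<rho> (Suc k))))"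
  by (rule PiE_mem[OF _ permuted_index])

lemma bidual_norm_nonneg:
  assumes "z \<in> prod_space {1..m} (\<lambda>i. bidual (E i))" "k < m"
  shows "0 \<le> lnorm (bidual (E (\<rho> (Suc k)))) (z (\<rho> (Suc k)))"
proof -
  interpret normed_riesz_space "bidual (E (\<rho> (Suc k)))"
    using assms(2) by (intro normed_riesz_space.dual_normed_riesz bspec[OF E] permuted_index)
  show ?thesis
    using bidual_component[OF assms] by (rule lnorm_nonneg)
qed

context
  fixes B :: "(nat \<Rightarrow> 'e) \<Rightarrow> real" and K :: real
  assumes B: "bounded_form {1..m} E K B" and K: "0 \<le> K"
begin

text \<open>Every step collects one norm. The index l starts at 0, whereas steps are numbered from
  1, hence \<open>\<rho> (Suc l)\<close>.\<close>

lemma apply_biduals_form: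
  assumes z: "z \<in> prod_space {1..m} (\<lambda>i. bidual (E i))" and "k \<le> m"
  shows "bounded_form (remaining m \<rho> k) E
      (K * (\<Prod>l<k. lnorm (bidual (E (\<rho> (Suc l)))) (z (\<rho> (Suc l))))) (apply_biduals m E \<rho> z k B)"
  using \<open>k \<le> m\<close>
proof (induction k)
  case 0
  then show ?case
    using B by (simp add: remaining_0)
next
  case (Suc k)
  let ?N = "\<lambda>l. lnorm (bidual (E (\<rho> (Suc l)))) (z (\<rho> (Suc l)))"
  have k: "k < m"
    using Suc by simp
  have "bounded_form (remaining m \<rho> (Suc k)) E ((K * (\<Prod>l<k. ?N l)) * ?N k)
      (apply_biduals m E \<rho> z (Suc k) B)"
  proof (rule bounded_form_extend)
    show "bounded_form (insert (\<rho> (Suc k)) (remaining m \<rho> (Suc k))) E (K * (\<Prod>l<k. ?N l))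
        (apply_biduals m E \<rho> z k B)"
      using Suc k by (simp flip: remaining_Suc(1))
    show "0 \<le> K * (\<Prod>l<k. ?N l)"
      using K k bidual_norm_nonneg[OF z] by (intro mult_nonneg_nonneg prod_nonneg) auto
    show "normed_riesz_space (E i)" if "i \<in> insert (\<rho> (Suc k)) (remaining m \<rho> (Suc k))" for i
      using that remaining_subset unfolding remaining_Suc(1)[OF k, symmetric] by (intro bspec[OF E]) blast
    show "z (\<rho> (Suc k)) \<in> carrier (bidual (E (\<rho> (Suc k))))"
      using z k by (rule bidual_component)
  qed (simp_all add: remaining_removed remaining_finite apply_biduals_Suc del: apply_biduals.simps)
  then show ?case
    by (simp add: mult_ac del: apply_biduals.simps)
qed

text \<open>Licenses the use of linearity and positivity of the bidual element at step k + 1, as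
  both are available on the dual only.\<close>

lemma slice_apply_biduals_in_dual:
  assumes z: "z \<in> prod_space {1..m} (\<lambda>i. bidual (E i))" and k: "k < m"
    and x: "x \<in> prod_space (remaining m \<rho> (Suc k)) E"
  shows "slice E (\<rho> (Suc k)) (apply_biduals m E \<rho> z k B) x \<in> carrier (dual_lattice (E (\<rho> (Suc k))))"
proof (rule slice_in_dual[OF _ _ _ _ _ x])
  let ?N = "\<lambda>l. lnorm (bidual (E (\<rho> (Suc l)))) (z (\<rho> (Suc l)))"
  show "bounded_form (insert (\<rho> (Suc k)) (remaining m \<rho> (Suc k))) E (K * (\<Prod>l<k. ?N l))
      (apply_biduals m E \<rho> z k B)"
    using apply_biduals_form[OF z, of k] k by (simp flip: remaining_Suc(1))
  show "0 \<le> K * (\<Prod>l<k. ?N l)"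
    using K k bidual_norm_nonneg[OF z] by (intro mult_nonneg_nonneg prod_nonneg) auto
  show "normed_riesz_space (E i)" if "i \<in> insert (\<rho> (Suc k)) (remaining m \<rho> (Suc k))" for i
    using that remaining_subset unfolding remaining_Suc(1)[OF k, symmetric] by (intro bspec[OF E]) blast
qed (simp_all add: remaining_removed remaining_finite)

text \<open>A positive form has positive slices at positive points, and a positive bidual element
  takes nonnegative values on them; so positivity survives every step.\<close>

lemma apply_biduals_pos:
  assumes z: "z \<in> prod_space {1..m} (\<lambda>i. bidual (E i))"
    and z0: "\<And>i. i \<in> {1..m} \<Longrightarrow> z i \<in> pos_cone (bidual (E i))"
    and B0: "\<And>x. \<lbrakk>x \<in> prod_space {1..m} E; \<And>i. i \<in> {1..m} \<Longrightarrow> x i \<in> pos_cone (E i)\<rbrakk> \<Longrightarrow> 0 \<le> B x"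
    and "k \<le> m" "x \<in> prod_space (remaining m \<rho> k) E"
    and "\<And>i. i \<in> remaining m \<rho> k \<Longrightarrow> x i \<in> pos_cone (E i)"
  shows "0 \<le> apply_biduals m E \<rho> z k B x"
  using assms(4,5,6)
proof (induction k arbitrary: x)
  case 0
  then show ?case
    using B0 by (simp add: remaining_0)
next
  case (Suc k)
  let ?j = "\<rho> (Suc k)"
  have k: "k < m"
    using Suc by simp
  have "0 \<le> slice E ?j (apply_biduals m E \<rho> z k B) x t" if t: "t \<in> pos_cone (E ?j)" for t
  proof -
    have tc: "t \<in> carrier (E ?j)"
      using t by (simp add: pos_cone_def)
    have "0 \<le> apply_biduals m E \<rho> z k B (x(?j := t))"
    proof (rule Suc.IH)
      show "x(?j := t) \<in> prod_space (remaining m \<rho> k) E"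
        unfolding remaining_Suc(1)[OF k] by (rule prod_space_insert_upd[OF Suc.prems(2) tc])
      show "(x(?j := t)) i \<in> pos_cone (E i)" if "i \<in> remaining m \<rho> k" for i
        using that Suc.prems(3) t by (auto simp: remaining_Suc(1)[OF k])
    qed (use k in simp)
    then show ?thesis
      using tc by (simp add: slice_def)
  qed
  then have "slice E ?j (apply_biduals m E \<rho> z k B) x \<in> pos_cone (dual_lattice (E ?j))"
    using slice_apply_biduals_in_dual[OF z k Suc.prems(2)]
    by (simp add: pos_cone_def[of "dual_lattice _"] dual_le_iff)
  then show ?case
    using z0[OF permuted_index[OF k]] apply_biduals_Suc[OF Suc.prems(2)]
    by (simp add: pos_cone_def[of "bidual _"] dual_le_iff[of "dual_lattice _"] del: apply_biduals.simps)
qed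

lemma apply_biduals_upd_unused:
  assumes "i \<notin> \<rho> ` {1..k}"
  shows "apply_biduals m E \<rho> (z(i := w)) k B = apply_biduals m E \<rho> z k B"
  using assms
proof (induction k)
  case (Suc k)
  then have "i \<notin> \<rho> ` {1..k}" "i \<noteq> \<rho> (Suc k)"
    by auto
  then show ?case
    using Suc.IH by simp
qed simp

text \<open>The argument at i enters at exactly one step. Before it nothing changes, at it the
  dependence is plain evaluation, and afterwards linear combinations pass through the other bidual
  elements because slices lie in the dual. Two coefficients treat sums and multiples at
  once.\<close>

lemma apply_biduals_linear_bidual:
  assumes z: "z \<in> prod_space {1..m} (\<lambda>i. bidual (E i))" and i: "i \<in> {1..m}"
    and a: "a \<in> carrier (bidual (E i))" and b: "b \<in> carrier (bidual (E i))"
    and c: "c = \<alpha> *\<^sub>R a + \<beta> *\<^sub>R b"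
    and "k \<le> m" "i \<in> \<rho> ` {1..k}" "x \<in> prod_space (remaining m \<rho> k) E"
  shows "apply_biduals m E \<rho> (z(i := c)) k B x =
    \<alpha> * apply_biduals m E \<rho> (z(i := a)) k B x + \<beta> * apply_biduals m E \<rho> (z(i := b)) k B x"
  using assms(6,7,8)
proof (induction k arbitrary: x)
  case (Suc k)
  let ?j = "\<rho> (Suc k)"
  let ?A = "\<lambda>w. apply_biduals m E \<rho> (z(i := w)) k B"
  have k: "k < m"
    using Suc by simp
  note Suc_eq = apply_biduals_Suc[OF Suc.prems(3)]
  have zu: "z(i := w) \<in> prod_space {1..m} (\<lambda>i. bidual (E i))" if "w \<in> carrier (bidual (E i))" for w
    using prod_space_upd[of z "{1..m}" "\<lambda>i. bidual (E i)" i w] z i that by blast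
  show ?case
  proof (cases "i = ?j")
    case True
    then have eq: "?A w = apply_biduals m E \<rho> z k B" for w
      using remaining_Suc(2)[OF k] by (intro apply_biduals_upd_unused) simp
    show ?thesis
      unfolding Suc_eq eq using True by (simp add: c scaleR_fun_apply)
  next
    case False
    then have ik: "i \<in> \<rho> ` {1..k}"
      using Suc.prems(2) by (auto simp: atLeastAtMostSuc_conv)
    have "slice E ?j (?A c) x = \<alpha> *\<^sub>R slice E ?j (?A a) x + \<beta> *\<^sub>R slice E ?j (?A b) x"
    proof
      fix t
      show "slice E ?j (?A c) x t = (\<alpha> *\<^sub>R slice E ?j (?A a) x + \<beta> *\<^sub>R slice E ?j (?A b) x) t"
      proof (cases "t \<in> carrier (E ?j)")
        case True
        then have "x(?j := t) \<in> prod_space (remaining m \<rho> k) E"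
          unfolding remaining_Suc(1)[OF k] by (intro prod_space_insert_upd Suc.prems(3))
        from Suc.IH[OF less_imp_le[OF k] ik this] show ?thesis
          using True by (simp only: slice_def if_True plus_fun_apply scaleR_fun_apply real_scaleR_def)
      qed (simp add: slice_def scaleR_fun_apply)
    qed
    moreover have "slice E ?j (?A w) x \<in> carrier (dual_lattice (E ?j))" if "w \<in> carrier (bidual (E i))" for w
      using slice_apply_biduals_in_dual[OF zu[OF that] k Suc.prems(3)] .
    ultimately have "z ?j (slice E ?j (?A c) x) =
        \<alpha> * z ?j (slice E ?j (?A a) x) + \<beta> * z ?j (slice E ?j (?A b) x)"
      using bidual_lincomb[OF bidual_component[OF z k]] a b by (simp only:)
    moreover have upd: "(z(i := w)) ?j = z ?j" for w
      using False by simp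
    ultimately show ?thesis
      unfolding Suc_eq upd by (simp only:)
  qed
qed simp

end

text \<open>Boundedness of B1 and B2 puts their slices into the dual, where each bidual element is
  linear. This yields linearity of the extension in the functional y.\<close>

lemma apply_biduals_linear_form:
  assumes z: "z \<in> prod_space {1..m} (\<lambda>i. bidual (E i))"
    and B1: "bounded_form {1..m} E K1 B1" "0 \<le> K1" and B2: "bounded_form {1..m} E K2 B2" "0 \<le> K2"
    and B: "\<And>x. x \<in> prod_space {1..m} E \<Longrightarrow> B x = \<alpha> * B1 x + \<beta> * B2 x"
    and "k \<le> m" "x \<in> prod_space (remaining m \<rho> k) E"
  shows "apply_biduals m E \<rho> z k B x =
    \<alpha> * apply_biduals m E \<rho> z k B1 x + \<beta> * apply_biduals m E \<rho> z k B2 x"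
  using assms(7,8)
proof (induction k arbitrary: x)
  case 0
  then show ?case
    using B by (simp add: remaining_0)
next
  case (Suc k)
  let ?j = "\<rho> (Suc k)"
  let ?A = "\<lambda>B. apply_biduals m E \<rho> z k B"
  have k: "k < m"
    using Suc by simp
  note Suc_eq = apply_biduals_Suc[OF Suc.prems(2)]
  have "slice E ?j (?A B) x = \<alpha> *\<^sub>R slice E ?j (?A B1) x + \<beta> *\<^sub>R slice E ?j (?A B2) x"
  proof
    fix t
    show "slice E ?j (?A B) x t = (\<alpha> *\<^sub>R slice E ?j (?A B1) x + \<beta> *\<^sub>R slice E ?j (?A B2) x) t"
    proof (cases "t \<in> carrier (E ?j)")
      case True
      then have "x(?j := t) \<in> prod_space (remaining m \<rho> k) E"
        unfolding remaining_Suc(1)[OF k] by (intro prod_space_insert_upd Suc.prems(2))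
      then show ?thesis
        using Suc.IH k True by (simp add: slice_def scaleR_fun_apply)
    qed (simp add: slice_def scaleR_fun_apply)
  qed
  moreover have "slice E ?j (?A B1) x \<in> carrier (dual_lattice (E ?j))"
    "slice E ?j (?A B2) x \<in> carrier (dual_lattice (E ?j))"
    using slice_apply_biduals_in_dual[OF B1 z k Suc.prems(2)]
      slice_apply_biduals_in_dual[OF B2 z k Suc.prems(2)] .
  ultimately have "z ?j (slice E ?j (?A B) x) =
      \<alpha> * z ?j (slice E ?j (?A B1) x) + \<beta> * z ?j (slice E ?j (?A B2) x)"
    using bidual_lincomb[OF bidual_component[OF z k]] by (simp only:)
  then show ?case
    by (simp add: Suc_eq del: apply_biduals.simps)
qed

end

lemma prod_space_empty: "(\<lambda>_. undefined) \<in> prod_space {} E"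
  by simp

section \<open>Extensions of positive operators with values in a sequence sum\<close>

context riesz_sequence_sum
begin

interpretation riesz: normed_riesz_space "F n" for n
  by (rule riesz)

context
  fixes m :: nat and E :: "nat \<Rightarrow> 'e::real_vector normed_order" and \<rho> :: "nat \<Rightarrow> nat"
    and A :: "(nat \<Rightarrow> 'e) \<Rightarrow> nat \<Rightarrow> 'f" and C :: real
  assumes E: "\<forall>i\<in>{1..m}. normed_riesz_space (E i)" and \<rho>: "\<rho> permutes {1..m}"
    and A: "positive_multilinear {1..m} E G A" and C: "0 \<le> C"
    and bound: "\<forall>x\<in>prod_space {1..m} E. lnorm G (A x) \<le> C * (\<Prod>i\<in>{1..m}. lnorm (E i) (x i))"
begin

lemma multilinear_A: "multilinear {1..m} E G A"
  using A by (simp add: positive_multilinear_def)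

abbreviation composite :: "((nat \<Rightarrow> 'f) \<Rightarrow> real) \<Rightarrow> (nat \<Rightarrow> 'e) \<Rightarrow> real" where
  "composite y \<equiv> \<lambda>x\<in>prod_space {1..m} E. y (A x)"

lemma composite_form:
  assumes y: "y \<in> carrier (dual_lattice G)"
  shows "bounded_form {1..m} E (lnorm (dual_lattice G) y * C) (composite y)"
  unfolding bounded_form_def
proof (intro conjI ballI allI)
  note Ac = multilinear_closed[OF multilinear_A]
  fix x assume x: "x \<in> prod_space {1..m} E"
  have "\<bar>y (A x)\<bar> \<le> lnorm (dual_lattice G) y * lnorm G (A x)"
    using y Ac[OF x] by (rule dual_norm_bound)
  also have "\<dots> \<le> lnorm (dual_lattice G) y * (C * (\<Prod>i\<in>{1..m}. lnorm (E i) (x i)))"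
    using bspec[OF bound x] dual_norm_nonneg[OF y] by (rule mult_left_mono)
  finally show "\<bar>composite y x\<bar> \<le> lnorm (dual_lattice G) y * C * (\<Prod>i\<in>{1..m}. lnorm (E i) (x i))"
    using x by (simp add: mult_ac)
  fix i a assume i: "i \<in> {1..m}" and a: "a \<in> carrier (E i)"
  interpret Ei: normed_riesz_space "E i"
    using E i by (rule bspec)
  have upd: "x(i := c) \<in> prod_space {1..m} E" if "c \<in> carrier (E i)" for c
    using x i that by (rule prod_space_upd)
  show "composite y (x(i := c *\<^sub>R a)) = c * composite y (x(i := a))" for c
    using upd[OF a] upd[OF Ei.carrier_scaleR[OF a]] multilinear_scaleR[OF multilinear_A x i a]
      dual_scaleR[OF y Ac[OF upd[OF a]]] by (simp only: restrict_apply if_True)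
  fix b assume b: "b \<in> carrier (E i)"
  show "composite y (x(i := a + b)) = composite y (x(i := a)) + composite y (x(i := b))"
    using upd[OF a] upd[OF b] upd[OF Ei.carrier_add[OF a b]] multilinear_add[OF multilinear_A x i a b]
      dual_add[OF y Ac[OF upd[OF a]] Ac[OF upd[OF b]]] by (simp only: restrict_apply if_True)
qed

lemma composite_constant_nonneg: "y \<in> carrier (dual_lattice G) \<Longrightarrow> 0 \<le> lnorm (dual_lattice G) y * C"
  using C dual_norm_nonneg by simp

lemma aron_berner_eval:
  "y \<in> carrier (dual_lattice G) \<Longrightarrow>
    aron_berner m E G \<rho> A z y = apply_biduals m E \<rho> z m (composite y) (\<lambda>_. undefined)"
  by (simp add: aron_berner_def)

text \<open>Linearity in y is linearity of the iteration in the composite form. The bound comes from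
  the constant of that form, C times the norm of y, multiplied by the norms of the entries of
  z.\<close>

lemma aron_berner_in_bidual:
  assumes z: "z \<in> prod_space {1..m} (\<lambda>i. bidual (E i))"
  shows "aron_berner m E G \<rho> A z \<in> carrier (bidual G)"
  unfolding dual_iff[of "aron_berner m E G \<rho> A z"]
proof (intro conjI ballI allI impI)
  have u: "(\<lambda>_. undefined) \<in> prod_space (remaining m \<rho> m) E"
    unfolding remaining_all[OF E \<rho>] by (rule prod_space_empty)
  have lin: "apply_biduals m E \<rho> z m (composite y) (\<lambda>_. undefined) =
      \<alpha> * apply_biduals m E \<rho> z m (composite y1) (\<lambda>_. undefined) +
      \<beta> * apply_biduals m E \<rho> z m (composite y2) (\<lambda>_. undefined)"
    if "y1 \<in> carrier (dual_lattice G)" "y2 \<in> carrier (dual_lattice G)"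
      "\<And>g. y g = \<alpha> * y1 g + \<beta> * y2 g" for y y1 y2 \<alpha> \<beta>
    using that
    by (intro apply_biduals_linear_form[OF E \<rho> z composite_form composite_constant_nonneg
          composite_form composite_constant_nonneg _ order_refl u]) simp_all
  fix y1 assume y1: "y1 \<in> carrier (dual_lattice G)"
  show "aron_berner m E G \<rho> A z (c *\<^sub>R y1) = c * aron_berner m E G \<rho> A z y1" for c
    using lin[OF y1 y1, of "c *\<^sub>R y1" c 0] y1 subspace_scale[OF subspace_dual y1]
    by (simp add: aron_berner_eval scaleR_fun_apply)
  fix y2 assume y2: "y2 \<in> carrier (dual_lattice G)"
  show "aron_berner m E G \<rho> A z (y1 + y2) = aron_berner m E G \<rho> A z y1 + aron_berner m E G \<rho> A z y2"
    using lin[OF y1 y2, of "y1 + y2" 1 1] y1 y2 subspace_add[OF subspace_dual y1 y2]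
    by (simp add: aron_berner_eval)
next
  let ?P = "\<Prod>l<m. lnorm (bidual (E (\<rho> (Suc l)))) (z (\<rho> (Suc l)))"
  have u: "(\<lambda>_. undefined) \<in> prod_space (remaining m \<rho> m) E"
    unfolding remaining_all[OF E \<rho>] by (rule prod_space_empty)
  have "\<bar>aron_berner m E G \<rho> A z y\<bar> \<le> (C * ?P) * lnorm (dual_lattice G) y"
    if y: "y \<in> carrier (dual_lattice G)" for y
    using bounded_form_bound[OF apply_biduals_form[OF E \<rho> composite_form[OF y]
        composite_constant_nonneg[OF y] z order_refl] u]
    by (simp add: aron_berner_eval[OF y] remaining_all[OF E \<rho>] mult_ac)
  then show "\<exists>K. \<forall>y\<in>carrier (dual_lattice G). \<bar>aron_berner m E G \<rho> A z y\<bar> \<le> K * lnorm (dual_lattice G) y"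
    by blast
qed (simp add: aron_berner_def)

lemma aron_berner_lincomb:
  assumes z: "z \<in> prod_space {1..m} (\<lambda>i. bidual (E i))" and i: "i \<in> {1..m}"
    and a: "a \<in> carrier (bidual (E i))" and b: "b \<in> carrier (bidual (E i))"
    and c: "c = \<alpha> *\<^sub>R a + \<beta> *\<^sub>R b"
  shows "aron_berner m E G \<rho> A (z(i := c)) =
    \<alpha> *\<^sub>R aron_berner m E G \<rho> A (z(i := a)) + \<beta> *\<^sub>R aron_berner m E G \<rho> A (z(i := b))"
proof
  fix y
  have u: "(\<lambda>_. undefined) \<in> prod_space (remaining m \<rho> m) E"
    unfolding remaining_all[OF E \<rho>] by (rule prod_space_empty)
  have im: "i \<in> \<rho> ` {1..m}"
    using i permutes_image[OF \<rho>] by simp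
  show "aron_berner m E G \<rho> A (z(i := c)) y =
    (\<alpha> *\<^sub>R aron_berner m E G \<rho> A (z(i := a)) + \<beta> *\<^sub>R aron_berner m E G \<rho> A (z(i := b))) y"
  proof (cases "y \<in> carrier (dual_lattice G)")
    case True
    show ?thesis
      using apply_biduals_linear_bidual[OF E \<rho> composite_form[OF True] composite_constant_nonneg[OF True]
          z i a b c order_refl im u]
      by (simp only: aron_berner_eval[OF True] plus_fun_apply scaleR_fun_apply real_scaleR_def)
  qed (simp add: aron_berner_def scaleR_fun_apply)
qed

text \<open>For positive y the composite form is positive, and the iteration preserves this.
  Positivity is also the source of the regularity of the extension.\<close>

lemma aron_berner_positive_multilinear:
  "positive_multilinear {1..m} (\<lambda>i. bidual (E i)) (bidual G) (aron_berner m E G \<rho> A)"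
  unfolding positive_multilinear_def multilinear_def
proof (intro conjI ballI allI impI)
  fix z assume z: "z \<in> prod_space {1..m} (\<lambda>i. bidual (E i))"
  show "aron_berner m E G \<rho> A z \<in> carrier (bidual G)"
    using z by (rule aron_berner_in_bidual)
  {
    assume z0: "\<forall>i\<in>{1..m}. le (bidual (E i)) 0 (z i)"
    show "le (bidual G) 0 (aron_berner m E G \<rho> A z)"
      unfolding dual_le_iff
    proof
      fix y assume yp: "y \<in> pos_cone (dual_lattice G)"
      then have y: "y \<in> carrier (dual_lattice G)"
        by (simp add: pos_cone_def)
      have "0 \<le> apply_biduals m E \<rho> z m (composite y) (\<lambda>_. undefined)"
      proof (rule apply_biduals_pos[OF E \<rho> composite_form[OF y] composite_constant_nonneg[OF y] z])
        show "z i \<in> pos_cone (bidual (E i))" if "i \<in> {1..m}" for i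
          using z z0 that by (auto simp: pos_cone_def)
        show "0 \<le> composite y x"
          if "x \<in> prod_space {1..m} E" "\<And>i. i \<in> {1..m} \<Longrightarrow> x i \<in> pos_cone (E i)" for x
          using positive_multilinear_pos[OF A that] yp that(1)
          by (simp add: pos_cone_def[of "dual_lattice G"] dual_le_iff)
      qed (simp_all add: remaining_all[OF E \<rho>])
      then show "0 y \<le> aron_berner m E G \<rho> A z y"
        by (simp add: aron_berner_eval[OF y])
    qed
  }
  fix i a assume i: "i \<in> {1..m}" and a: "a \<in> carrier (bidual (E i))"
  show "aron_berner m E G \<rho> A (z(i := c *\<^sub>R a)) = c *\<^sub>R aron_berner m E G \<rho> A (z(i := a))" for c
    using aron_berner_lincomb[OF z i a a, of "c *\<^sub>R a" c 0] by simp
  fix b assume b: "b \<in> carrier (bidual (E i))"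
  show "aron_berner m E G \<rho> A (z(i := a + b)) =
      aron_berner m E G \<rho> A (z(i := a)) + aron_berner m E G \<rho> A (z(i := b))"
    using aron_berner_lincomb[OF z i a b, of "a + b" 1 1] by simp
qed

text \<open>\<open>coord n\<close> evaluates at \<open>pull n \<phi>\<close>, and composing
  \<open>pull n \<phi>\<close> with A is the same as composing \<phi> with the n-th coordinate of A;
  so both iterations start from the same form.\<close>

lemma coord_aron_berner:
  "coord n (aron_berner m E G \<rho> A z) = aron_berner m E (F n) \<rho> (\<lambda>x. A x n) z"
proof
  fix \<phi>
  show "coord n (aron_berner m E G \<rho> A z) \<phi> = aron_berner m E (F n) \<rho> (\<lambda>x. A x n) z \<phi>"
  proof (cases "\<phi> \<in> carrier (dual_lattice (F n))")
    case True
    have "composite (pull n \<phi>) = (\<lambda>x\<in>prod_space {1..m} E. \<phi> (A x n))"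
      using multilinear_closed[OF multilinear_A] by (intro restrict_ext) (simp add: pull_def)
    then show ?thesis
      using True aron_berner_eval[OF pull_closed[OF True]] by (simp add: coord_def aron_berner_def)
  qed (simp add: coord_def aron_berner_def)
qed

end

theorem aron_berner_riesz_sum:
  assumes F: "\<And>n. aron_berner_riesz TYPE('e::real_vector) (F n)"
  shows "aron_berner_riesz TYPE('e) G"
  unfolding aron_berner_riesz_def
proof (intro allI impI, elim conjE)
  fix m :: nat and E :: "nat \<Rightarrow> 'e normed_order" and A \<rho>
  assume m: "1 \<le> m" and bE: "\<forall>i\<in>{1..m}. banach_lattice (E i)"
    and A: "riesz_multimorphism m E G A" and \<rho>: "\<rho> permutes {1..m}"
  have E: "normed_riesz_space (E i)" if "i \<in> {1..m}" for i
    using bE that by (blast intro: banach_lattice.normed_riesz)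
  have reg: "regular_multilinear {1..m} E G A"
    and mod: "\<And>x. x \<in> prod_space {1..m} E \<Longrightarrow>
      modulus G (A x) = A (\<lambda>i\<in>{1..m}. modulus (E i) (x i))"
    using A by (auto simp: riesz_multimorphism_def)
  have ml: "multilinear {1..m} E G A"
    using reg E by (intro regular_imp_multilinear) (auto intro: add_closed scaleR_closed)
  have mod_in: "(\<lambda>i\<in>{1..m}. modulus (E i) (x i)) \<in> prod_space {1..m} E"
    if "x \<in> prod_space {1..m} E" for x
    using that normed_riesz_space.modulus_in_carrier[OF E] by (auto simp: PiE_iff)
  \<comment> \<open>At a positive x the moduli change nothing, so A x is its own modulus and every
    coordinate of it is positive.\<close>
  have pm: "positive_multilinear {1..m} E G A"
    unfolding positive_multilinear_def
  proof (intro conjI ballI impI ml)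
    fix x assume x: "x \<in> prod_space {1..m} E" and x0: "\<forall>i\<in>{1..m}. le (E i) 0 (x i)"
    have "modulus (E i) (x i) = x i" if i: "i \<in> {1..m}" for i
      using x x0 i by (intro normed_riesz_space.modulus_of_pos[OF E]) (auto simp: pos_cone_def)
    then have "(\<lambda>i\<in>{1..m}. modulus (E i) (x i)) = x"
      using x by (auto simp: PiE_iff extensional_def fun_eq_iff)
    then have "A x = modulus G (A x)"
      using mod[OF x] by simp
    also have "\<dots> = (\<lambda>n. modulus (F n) (A x n))"
      using modulus_coordinatewise[OF multilinear_closed[OF ml x]] .
    finally have eq: "A x = (\<lambda>n. modulus (F n) (A x n))" .
    have "A x n \<in> pos_cone (F n)" for n
      using riesz.modulus_pos[OF coordinate_closed[OF multilinear_closed[OF ml x]], of n]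
      unfolding fun_cong[OF eq, symmetric] .
    then show "le G 0 (A x)"
      by (simp add: le_coordinatewise pos_cone_def)
  qed
  have "\<exists>C\<ge>0. \<forall>x\<in>prod_space {1..m} E. (\<forall>i\<in>{1..m}. x i \<in> pos_cone (E i)) \<longrightarrow>
      lnorm G (A x) \<le> C * (\<Prod>i\<in>{1..m}. lnorm (E i) (x i))"
    by (rule positive_multilinear_bounded[OF pm finite_atLeastAtMost]) (rule bspec[OF bE])
  then obtain C where C: "0 \<le> C" "\<forall>x\<in>prod_space {1..m} E. (\<forall>i\<in>{1..m}. x i \<in> pos_cone (E i)) \<longrightarrow>
      lnorm G (A x) \<le> C * (\<Prod>i\<in>{1..m}. lnorm (E i) (x i))"
    by (elim exE conjE)
  \<comment> \<open>Norms do not change under moduli, so the multimorphism identity carries the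
    bound from the cones to all x.\<close>
  have bound: "lnorm G (A x) \<le> C * (\<Prod>i\<in>{1..m}. lnorm (E i) (x i))" if x: "x \<in> prod_space {1..m} E" for x
  proof -
    have xi: "x i \<in> carrier (E i)" if "i \<in> {1..m}" for i
      using x that by (rule PiE_mem)
    have "lnorm G (A x) = lnorm G (A (\<lambda>i\<in>{1..m}. modulus (E i) (x i)))"
      using lnorm_modulus[OF multilinear_closed[OF ml x]] mod[OF x] by simp
    also have "\<dots> \<le> C * (\<Prod>i\<in>{1..m}. lnorm (E i) ((\<lambda>i\<in>{1..m}. modulus (E i) (x i)) i))"
      by (rule C(2)[rule_format, OF mod_in[OF x]]) (simp add: normed_riesz_space.modulus_pos[OF E xi])
    also have "(\<Prod>i\<in>{1..m}. lnorm (E i) ((\<lambda>i\<in>{1..m}. modulus (E i) (x i)) i)) =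
        (\<Prod>i\<in>{1..m}. lnorm (E i) (x i))"
      by (intro prod.cong) (simp_all add: normed_riesz_space.lnorm_modulus[OF E xi])
    finally show ?thesis .
  qed
  have An: "riesz_multimorphism m E (F n) (\<lambda>x. A x n)" for n
    unfolding riesz_multimorphism_def
  proof (intro conjI ballI)
    have pos: "positive_multilinear {1..m} E (F n) (\<lambda>x. P x n)"
      if "positive_multilinear {1..m} E G P" for P
      using that unfolding positive_multilinear_def multilinear_def
      by (auto simp: coordinate_closed le_coordinatewise scaleR_fun_apply)
    obtain P Q where P: "positive_multilinear {1..m} E G P" and Q: "positive_multilinear {1..m} E G Q"
      and PQ: "\<forall>x\<in>prod_space {1..m} E. A x = P x - Q x"
      using reg unfolding regular_multilinear_def by blast
    show "regular_multilinear {1..m} E (F n) (\<lambda>x. A x n)"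
      unfolding regular_multilinear_def
      by (intro exI[of _ "\<lambda>x. P x n"] exI[of _ "\<lambda>x. Q x n"] conjI ballI pos[OF P] pos[OF Q])
        (simp only: bspec[OF PQ] minus_apply)
    show "modulus (F n) (A x n) = A (\<lambda>i\<in>{1..m}. modulus (E i) (x i)) n"
      if x: "x \<in> prod_space {1..m} E" for x
      using mod[OF x] modulus_coordinatewise[OF multilinear_closed[OF ml x]] by metis
  qed
  have ABn: "riesz_multimorphism m (\<lambda>i. bidual (E i)) (bidual (F n)) (aron_berner m E (F n) \<rho> (\<lambda>x. A x n))"
    for n
    using F[of n] m bE An[of n] \<rho> unfolding aron_berner_riesz_def by blast
  have bound': "\<forall>x\<in>prod_space {1..m} E. lnorm G (A x) \<le> C * (\<Prod>i\<in>{1..m}. lnorm (E i) (x i))"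
    and E': "\<forall>i\<in>{1..m}. normed_riesz_space (E i)"
    using bound E by blast+
  note ab = E' \<rho> pm C(1) bound'
  let ?AB = "aron_berner m E G \<rho> A"
  have coord: "coord n (?AB z) = aron_berner m E (F n) \<rho> (\<lambda>x. A x n) z" for n z
    by (rule coord_aron_berner[OF ab])
  show "riesz_multimorphism m (\<lambda>i. bidual (E i)) (bidual G) ?AB"
    unfolding riesz_multimorphism_def
  proof (intro conjI ballI)
    \<comment> \<open>The extension is positive, hence regular with 0 as the subtracted
      operator.\<close>
    have "positive_multilinear {1..m} (\<lambda>i. bidual (E i)) (bidual G) (\<lambda>_. 0)"
      by (auto simp: positive_multilinear_def multilinear_def subspace_0[OF subspace_dual] dual_le_iff)
    then show "regular_multilinear {1..m} (\<lambda>i. bidual (E i)) (bidual G) ?AB"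
      unfolding regular_multilinear_def using aron_berner_positive_multilinear[OF ab]
      by (intro exI[of _ ?AB] exI[of _ "\<lambda>_. 0"]) simp
    fix z assume z: "z \<in> prod_space {1..m} (\<lambda>i. bidual (E i))"
    let ?z = "\<lambda>i\<in>{1..m}. modulus (bidual (E i)) (z i)"
    have z': "?z \<in> prod_space {1..m} (\<lambda>i. bidual (E i))"
    proof -
      have "modulus (bidual (E i)) (z i) \<in> carrier (bidual (E i))" if i: "i \<in> {1..m}" for i
        using PiE_mem[OF z i] E[OF i]
        by (intro normed_riesz_space.modulus_in_carrier normed_riesz_space.dual_normed_riesz)
      then show ?thesis
        by simp
    qed
    \<comment> \<open>The extension at the moduli is the candidate; in each coordinate the identity
      is the one provided by \<open>ABn\<close>.\<close>
    show "modulus (bidual G) (?AB z) = ?AB ?z"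
    proof (rule bidual_modulus_coord)
      show "?AB z \<in> carrier (bidual G)" "?AB ?z \<in> carrier (bidual G)"
        by (rule aron_berner_in_bidual[OF ab z], rule aron_berner_in_bidual[OF ab z'])
      show "modulus (bidual (F n)) (coord n (?AB z)) = coord n (?AB ?z)" for n
        unfolding coord using ABn[of n] z unfolding riesz_multimorphism_def by blast
    qed
  qed
qed

end

theorem proposition3p10:
  fixes p :: real and F :: "nat \<Rightarrow> 'f::real_vector normed_order"
  assumes "1 < p"
    and "\<And>n. banach_lattice (F n)"
    and "\<And>n. aron_berner_riesz TYPE('e::real_vector) (F n)"
  shows "aron_berner_riesz TYPE('e) (c0_sum F) \<and> aron_berner_riesz TYPE('e) (lp_sum p F)"
proof
  have F: "normed_riesz_space (F n)" for n
    using assms(2) by (rule banach_lattice.normed_riesz)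
  show "aron_berner_riesz TYPE('e) (c0_sum F)"
    using c0_riesz_sequence_sum[OF F] assms(3) by (rule riesz_sequence_sum.aron_berner_riesz_sum)
  show "aron_berner_riesz TYPE('e) (lp_sum p F)"
    using lp_riesz_sequence_sum[OF F assms(1)] assms(3) by (rule riesz_sequence_sum.aron_berner_riesz_sum)
qed

end
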